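(* Let $A_1,\dots,A_r$ be distinct nonempty subsets of $[k]$ and let $S_1,\dots,S_r\subseteq\mathbf{X}^{[k]}$ be such that $S_i\in\sigma(A_i)$ and $E(\chi_{S_i}\mid\sigma(A_i)^* )$ is a.e. constant for every $1\le i\le r$. Then $\mu(S_1\cap\dots\cap S_r)=\mu(S_1)\mu(S_2)\cdots\mu(S_r)$.
   Context: Let $X_1,X_2,\dots$ be finite sets with $|X_1|<|X_2|<\cdots$ and $\omega$ a nonprincipal ultrafilter on $\mathbb{N}$ with ultralimit $\lim_\omega$. For a finite set $A$ (e.g. $A\subseteq[k]$), let $\mathbf{X}^A$ be the ultraproduct of the sets $X_i^A$: sequences $(p_i)$, $p_i\in X_i^A$, modulo $(p_i)\sim(q_i)$ iff $\{i:p_i=q_i\}\in\omega$. For $B_i\subseteq X_i^A$, the internal set $[\{B_i\}]$ consists of the classes $[(p_i)]$ with $\{i:p_i\in B_i\}\in\omega$, with $\mu_A([\{B_i\}])=\lim_\omega|B_i|/|X_i^A|$. $N\subseteq\mathbf{X}^A$ is null if for every $\epsilon>0$ it is contained in an internal set of measure $\le\epsilon$; a set is measurable if its symmetric difference with some internal set is null. Measurable sets form a $\sigma$-algebra $\mathcal{B}_A$ on which $\mu_A$ extends to a probability measure. Identify $\mathbf{X}^{[k]}$ with the product of $k$ copies of $\mathbf{X}$ and let $p_A:\mathbf{X}^{[k]}\to\mathbf{X}^A$ be the projection; $\sigma(A)=p_A^{-1}(\mathcal{B}_A)$ (and $\sigma(\emptyset)$ is trivial), $\mu=\mu_{[k]}$.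 For nonempty $A$, $\sigma(A)^*$ is the $\sigma$-algebra generated by the $\sigma(B)$ with $B\subseteq A$, $|B|=|A|-1$. $E(\cdot\mid\cdot)$ is conditional expectation w.r.t. $\mu$ and $\chi_S$ the indicator of $S$. *)

theory Defs
  imports "HOL-Probability.Conditional_Expectation"
begin

definition nonprincipal_ultrafilter :: "nat filter \<Rightarrow> bool" where
  "nonprincipal_ultrafilter \<omega> \<longleftrightarrow>
     \<omega> \<noteq> bot
     \<and> (\<forall>P. eventually P \<omega> \<or> eventually (\<lambda>i. \<not> P i) \<omega>)
     \<and> (\<forall>n. \<omega> \<noteq> principal {n})"

text \<open>
  The finite power of \<open>X i\<close> with exponent \<open>A\<close> is the set of extensional functions
  \<open>A \<rightarrow>\<^sub>E X i\<close>.
\<close>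

definition useq :: "(nat \<Rightarrow> 'a set) \<Rightarrow> 'b set \<Rightarrow> (nat \<Rightarrow> 'b \<Rightarrow> 'a) set" where
  "useq X A = {p. \<forall>i. p i \<in> A \<rightarrow>\<^sub>E X i}"

definition urel ::
  "nat filter \<Rightarrow> (nat \<Rightarrow> 'a set) \<Rightarrow> 'b set
    \<Rightarrow> ((nat \<Rightarrow> 'b \<Rightarrow> 'a) \<times> (nat \<Rightarrow> 'b \<Rightarrow> 'a)) set" where
  "urel \<omega> X A = {(p, q). p \<in> useq X A \<and> q \<in> useq X A \<and> eventually (\<lambda>i. p i = q i) \<omega>}"

definition ultraprod ::
  "nat filter \<Rightarrow> (nat \<Rightarrow> 'a set) \<Rightarrow> 'b set \<Rightarrow> (nat \<Rightarrow> 'b \<Rightarrow> 'a) set set" where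
  "ultraprod \<omega> X A = useq X A // urel \<omega> X A"

definition uclass ::
  "nat filter \<Rightarrow> (nat \<Rightarrow> 'a set) \<Rightarrow> 'b set \<Rightarrow> (nat \<Rightarrow> 'b \<Rightarrow> 'a)
    \<Rightarrow> (nat \<Rightarrow> 'b \<Rightarrow> 'a) set" where
  "uclass \<omega> X A p = urel \<omega> X A `` {p}"

definition set_seq :: "(nat \<Rightarrow> 'a set) \<Rightarrow> 'b set \<Rightarrow> (nat \<Rightarrow> ('b \<Rightarrow> 'a) set) \<Rightarrow> bool" where
  "set_seq X A B \<longleftrightarrow> (\<forall>i. B i \<subseteq> (A \<rightarrow>\<^sub>E X i))"

definition internal ::
  "nat filter \<Rightarrow> (nat \<Rightarrow> 'a set) \<Rightarrow> 'b set \<Rightarrow> (nat \<Rightarrow> ('b \<Rightarrow> 'a) set)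
    \<Rightarrow> (nat \<Rightarrow> 'b \<Rightarrow> 'a) set set" where
  "internal \<omega> X A B =
     uclass \<omega> X A ` {p \<in> useq X A. eventually (\<lambda>i. p i \<in> B i) \<omega>}"

definition internal_measure ::
  "nat filter \<Rightarrow> (nat \<Rightarrow> 'a set) \<Rightarrow> 'b set \<Rightarrow> (nat \<Rightarrow> ('b \<Rightarrow> 'a) set) \<Rightarrow> real" where
  "internal_measure \<omega> X A B =
     Lim \<omega> (\<lambda>i. real (card (B i)) / real (card (A \<rightarrow>\<^sub>E X i)))"

definition null_set ::
  "nat filter \<Rightarrow> (nat \<Rightarrow> 'a set) \<Rightarrow> 'b set \<Rightarrow> (nat \<Rightarrow> 'b \<Rightarrow> 'a) set set \<Rightarrow> bool" where
  "null_set \<omega> X A N \<longleftrightarrow>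
     (\<forall>\<epsilon>>0. \<exists>B. set_seq X A B \<and> N \<subseteq> internal \<omega> X A B \<and> internal_measure \<omega> X A B \<le> \<epsilon>)"

definition approximates ::
  "nat filter \<Rightarrow> (nat \<Rightarrow> 'a set) \<Rightarrow> 'b set \<Rightarrow> (nat \<Rightarrow> ('b \<Rightarrow> 'a) set)
    \<Rightarrow> (nat \<Rightarrow> 'b \<Rightarrow> 'a) set set \<Rightarrow> bool" where
  "approximates \<omega> X A B S \<longleftrightarrow>
     set_seq X A B
     \<and> null_set \<omega> X A ((S - internal \<omega> X A B) \<union> (internal \<omega> X A B - S))"

definition measurable_sets ::
  "nat filter \<Rightarrow> (nat \<Rightarrow> 'a set) \<Rightarrow> 'b set \<Rightarrow> (nat \<Rightarrow> 'b \<Rightarrow> 'a) set set set" where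
  "measurable_sets \<omega> X A = {S. S \<subseteq> ultraprod \<omega> X A \<and> (\<exists>B. approximates \<omega> X A B S)}"

text \<open>
  The extension of the measure from internal to measurable sets: a measurable set
  has the measure of any internal set that differs from it by a null set.
\<close>

definition mu_value ::
  "nat filter \<Rightarrow> (nat \<Rightarrow> 'a set) \<Rightarrow> 'b set \<Rightarrow> (nat \<Rightarrow> 'b \<Rightarrow> 'a) set set \<Rightarrow> real" where
  "mu_value \<omega> X A S =
     (THE m. \<exists>B. approximates \<omega> X A B S \<and> m = internal_measure \<omega> X A B)"

definition mu ::
  "nat filter \<Rightarrow> (nat \<Rightarrow> 'a set) \<Rightarrow> 'b set \<Rightarrow> (nat \<Rightarrow> 'b \<Rightarrow> 'a) set measure" where
  "mu \<omega> X A =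
     measure_of (ultraprod \<omega> X A) (measurable_sets \<omega> X A) (\<lambda>S. ennreal (mu_value \<omega> X A S))"

text \<open>
  When the ultrapower with exponent \<open>K\<close> is identified with the product of \<open>K\<close> copies of
  the ultraproduct of the \<open>X i\<close>, the projection onto the coordinates in \<open>A \<subseteq> K\<close>
  sends the class of \<open>p\<close> to the class of the sequence of restrictions of the \<open>p i\<close> to \<open>A\<close>
  (see \<open>uproj_uclass\<close>). The union below is over representatives, which all give the same class.
\<close>

definition uproj ::
  "nat filter \<Rightarrow> (nat \<Rightarrow> 'a set) \<Rightarrow> 'b set \<Rightarrow> (nat \<Rightarrow> 'b \<Rightarrow> 'a) set
    \<Rightarrow> (nat \<Rightarrow> 'b \<Rightarrow> 'a) set" where
  "uproj \<omega> X A c = (\<Union>p\<in>c. uclass \<omega> X A (\<lambda>i. restrict (p i) A))"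

text \<open>
  The sub-sigma-algebras are encoded as measures whose \<open>space\<close> is the ultrapower with exponent
  \<open>K\<close>, as expected by \<^const>\<open>real_cond_exp\<close>; only their \<open>sets\<close> matter.
  For \<open>A = {}\<close> the target of the projection is a single point, so the
  sigma-algebra is trivial.
\<close>

definition sigma_alg ::
  "nat filter \<Rightarrow> (nat \<Rightarrow> 'a set) \<Rightarrow> 'b set \<Rightarrow> 'b set \<Rightarrow> (nat \<Rightarrow> 'b \<Rightarrow> 'a) set measure" where
  "sigma_alg \<omega> X K A = vimage_algebra (ultraprod \<omega> X K) (uproj \<omega> X A) (mu \<omega> X A)"

definition sigma_alg_star ::
  "nat filter \<Rightarrow> (nat \<Rightarrow> 'a set) \<Rightarrow> 'b set \<Rightarrow> 'b set \<Rightarrow> (nat \<Rightarrow> 'b \<Rightarrow> 'a) set measure" where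
  "sigma_alg_star \<omega> X K A =
     sigma (ultraprod \<omega> X K)
       (\<Union>B\<in>{B. B \<subseteq> A \<and> card B = card A - 1}. sets (sigma_alg \<omega> X K B))"

lemma equiv_urel: "equiv (useq X A) (urel \<omega> X A)"
proof (rule equivI)
  show "urel \<omega> X A \<subseteq> useq X A \<times> useq X A" by (auto simp: urel_def)
  show "refl_on (useq X A) (urel \<omega> X A)" by (auto simp: refl_on_def urel_def)
  show "sym (urel \<omega> X A)" by (auto simp: sym_def urel_def eq_commute)
  show "trans (urel \<omega> X A)"
    by (auto simp: trans_def urel_def elim: eventually_elim2)
qed

lemma restrict_useq:
  assumes "p \<in> useq X K" "A \<subseteq> K"
  shows "(\<lambda>i. restrict (p i) A) \<in> useq X A"
  using assms by (auto simp: useq_def PiE_iff)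

lemma uproj_uclass:
  assumes "p \<in> useq X K" "A \<subseteq> K"
  shows "uproj \<omega> X A (uclass \<omega> X K p) = uclass \<omega> X A (\<lambda>i. restrict (p i) A)"
proof -
  have "uclass \<omega> X A (\<lambda>i. restrict (q i) A) = uclass \<omega> X A (\<lambda>i. restrict (p i) A)"
    if "q \<in> uclass \<omega> X K p" for q
  proof -
    from that have q: "q \<in> useq X K" "eventually (\<lambda>i. p i = q i) \<omega>"
      by (auto simp: uclass_def urel_def)
    have "eventually (\<lambda>i. restrict (p i) A = restrict (q i) A) \<omega>"
      using q(2) by eventually_elim simp
    then have "(\<lambda>i. restrict (p i) A, \<lambda>i. restrict (q i) A) \<in> urel \<omega> X A"
      using assms q(1) restrict_useq by (fastforce simp: urel_def)
    then show ?thesis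
      unfolding uclass_def using equiv_class_eq[OF equiv_urel] by metis
  qed
  moreover have "p \<in> uclass \<omega> X K p"
    using assms by (auto simp: uclass_def urel_def)
  ultimately show ?thesis unfolding uproj_def by blast
qed

end

theory Submission
  imports Defs
begin

text \<open>
  Proof idea. Replacing every \<open>S i\<close> by the cylinder \<open>T i\<close> over an internal approximation in
  the coordinates \<open>A i\<close> turns the claim into one about limits of densities in finite powers.
  Let \<open>A r\<close> have maximal cardinality. Freezing the coordinates outside \<open>A r\<close> to \<open>y\<close> turns
  each other \<open>T i\<close> into a cylinder over \<open>A i \<inter> A r\<close>, a proper subset of \<open>A r\<close>, so the section
  \<open>D y\<close> of the intersection of the other cylinders lies, in the limit, in
  \<open>\<sigma>(A r)\<^sup>*\<close>. The density of the full intersection minus the product of the densities of \<open>T r\<close>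
  and of the intersection of the others is the mean over \<open>y\<close> of
  \<open>d(T r \<inter> D y) - d(T r) d(D y)\<close>, hence in absolute value at most that of some \<open>y n\<close> in every
  coordinate \<open>n\<close>. Along such a sequence \<open>y\<close> it tends to 0 by the hypothesis on the conditional
  expectation, so no Fubini theorem on the ultraproduct is needed.
\<close>

section \<open>Splicing points along a set of coordinates\<close>

text \<open>With \<open>y\<close> fixed, \<open>\<lambda>x. splice_on K A x y\<close> freezes the
  coordinates outside \<open>A\<close>. Sections formed this way stay inside the full power over
  \<open>K\<close>, so the same density \<open>dens K\<close> measures them. The restriction to
  \<open>K\<close> keeps the result extensional.\<close>

definition splice_on :: "'b set \<Rightarrow> 'b set \<Rightarrow> ('b \<Rightarrow> 'a) \<Rightarrow> ('b \<Rightarrow> 'a) \<Rightarrow> 'b \<Rightarrow> 'a" where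
  "splice_on K A x y = (\<lambda>j\<in>K. if j \<in> A then x j else y j)"

lemma splice_on_in_PiE:
  "x \<in> K \<rightarrow>\<^sub>E V \<Longrightarrow> y \<in> K \<rightarrow>\<^sub>E V \<Longrightarrow> splice_on K A x y \<in> K \<rightarrow>\<^sub>E V"
  by (auto simp: splice_on_def)

lemma splice_on_splice_on:
  assumes "x \<in> K \<rightarrow>\<^sub>E V"
  shows "splice_on K A (splice_on K A x y) (splice_on K A y x) = x"
  using assms by (auto simp: splice_on_def fun_eq_iff PiE_def extensional_def)

text \<open>Exchanging the coordinates outside \<open>A\<close> is an involution on pairs of points.\<close>

lemma card_splice_on:
  assumes fin: "finite (K \<rightarrow>\<^sub>E V)" and Z: "Z \<subseteq> K \<rightarrow>\<^sub>E V"
  shows "card (K \<rightarrow>\<^sub>E V) * card Z = (\<Sum>y\<in>K \<rightarrow>\<^sub>E V. card {x \<in> K \<rightarrow>\<^sub>E V. splice_on K A x y \<in> Z})"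
proof -
  let ?P = "K \<rightarrow>\<^sub>E V"
  let ?h = "\<lambda>(y, x). (splice_on K A y x, splice_on K A x y)"
  have "bij_betw ?h (?P \<times> Z) (SIGMA y:?P. {x \<in> ?P. splice_on K A x y \<in> Z})"
    using Z by (intro bij_betw_byWitness[where f' = ?h])
      (auto simp: splice_on_splice_on subset_iff intro!: splice_on_in_PiE)
  then have "card (?P \<times> Z) = card (SIGMA y:?P. {x \<in> ?P. splice_on K A x y \<in> Z})"
    by (rule bij_betw_same_card)
  then show ?thesis using fin by (simp add: card_cartesian_product)
qed

section \<open>Ultrafilters and ultralimits\<close>

locale ultra_seq =
  fixes X :: "nat \<Rightarrow> 'a set" and \<omega> :: "nat filter"
  assumes finite_X: "finite (X n)" and nonempty_X: "X n \<noteq> {}"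
    and ultra: "nonprincipal_ultrafilter \<omega>"
begin

lemma ultra_not_bot: "\<omega> \<noteq> bot"
  using ultra by (simp add: nonprincipal_ultrafilter_def)

lemma eventually_not_iff: "eventually (\<lambda>i. \<not> P i) \<omega> \<longleftrightarrow> \<not> eventually P \<omega>"
proof
  assume "eventually (\<lambda>i. \<not> P i) \<omega>"
  show "\<not> eventually P \<omega>"
  proof
    assume "eventually P \<omega>"
    with \<open>eventually (\<lambda>i. \<not> P i) \<omega>\<close> have "eventually (\<lambda>i. False) \<omega>"
      by eventually_elim simp
    then show False using ultra_not_bot by (simp add: eventually_False)
  qed
next
  assume "\<not> eventually P \<omega>"
  then show "eventually (\<lambda>i. \<not> P i) \<omega>"
    using ultra by (auto simp: nonprincipal_ultrafilter_def)
qed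

lemma eventually_disj_iff:
  "eventually (\<lambda>i. P i \<or> Q i) \<omega> \<longleftrightarrow> eventually P \<omega> \<or> eventually Q \<omega>"
proof -
  have "eventually (\<lambda>i. P i \<or> Q i) \<omega> \<longleftrightarrow> \<not> eventually (\<lambda>i. \<not> P i \<and> \<not> Q i) \<omega>"
    by (subst eventually_not_iff[symmetric]) simp
  then show ?thesis by (simp add: eventually_conj_iff eventually_not_iff)
qed

text \<open>If \<open>{n}\<close> were large, a property would hold eventually exactly when it holds
  at \<open>n\<close>, which makes \<open>\<omega>\<close> principal.\<close>

lemma eventually_ne: "eventually (\<lambda>i. i \<noteq> n) \<omega>"
proof (rule ccontr)
  assume "\<not> eventually (\<lambda>i. i \<noteq> n) \<omega>"
  then have n: "eventually (\<lambda>i. i = n) \<omega>" by (simp add: eventually_not_iff)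
  have "eventually P \<omega> \<longleftrightarrow> P n" for P
  proof
    assume "eventually P \<omega>"
    with n have "eventually (\<lambda>i. P n) \<omega>" by eventually_elim simp
    then show "P n" using ultra_not_bot by (simp add: eventually_const_iff)
  next
    assume "P n"
    with n show "eventually P \<omega>" by (auto elim: eventually_mono)
  qed
  then have "\<omega> = principal {n}" by (simp add: filter_eq_iff eventually_principal)
  then show False using ultra by (simp add: nonprincipal_ultrafilter_def)
qed

text \<open>The finitely many indices below \<open>n\<close> are discarded one at a time. This makes
  the constraint \<open>n \<le> i\<close> harmless in the diagonal construction.\<close>

lemma eventually_ge: "eventually (\<lambda>i. n \<le> i) \<omega>"
proof -
  have "eventually (\<lambda>i. \<forall>m\<in>{..<n}. i \<noteq> m) \<omega>"
    by (intro eventually_ball_finite) (auto simp: eventually_ne)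
  then show ?thesis by eventually_elim (metis lessThan_iff not_le)
qed

text \<open>Compactness of the unit interval gives a cluster point of the image filter. For each
  neighbourhood of it the ultrafilter decides whether \<open>f\<close> eventually lies inside or
  outside, and outside is excluded, so the cluster point is a limit. Since \<open>Lim\<close> is a
  description operator, this existence is what gives \<open>internal_measure\<close> its
  meaning.\<close>

lemma bounded_tendsto:
  fixes f :: "nat \<Rightarrow> real"
  assumes "\<And>i. f i \<in> {0..1}"
  shows "(f \<longlongrightarrow> Lim \<omega> f) \<omega>"
proof -
  let ?F = "filtermap f \<omega>"
  have "?F \<noteq> bot" using ultra_not_bot by (simp add: filtermap_bot_iff)
  moreover have "eventually (\<lambda>x. x \<in> {0..1}) ?F"
    using assms by (simp add: eventually_filtermap)
  ultimately obtain l where l: "inf (nhds l) ?F \<noteq> bot"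
    using compact_Icc[of "0::real" 1] unfolding compact_filter by blast
  have "(f \<longlongrightarrow> l) \<omega>"
  proof (rule topological_tendstoI, rule ccontr)
    fix U assume U: "open U" "l \<in> U" "\<not> (\<forall>\<^sub>F x in \<omega>. f x \<in> U)"
    then have "eventually (\<lambda>x. x \<notin> U) ?F"
      by (simp add: eventually_filtermap eventually_not_iff)
    moreover have "eventually (\<lambda>x. x \<in> U) (nhds l)" using U eventually_nhds by blast
    ultimately have "eventually (\<lambda>x. False) (inf (nhds l) ?F)"
      unfolding eventually_inf by blast
    with l show False by (simp add: eventually_False)
  qed
  then show ?thesis using tendsto_Lim[OF ultra_not_bot] by metis
qed

section \<open>Densities at finite stages and their limits\<close>

text \<open>The sequence whose ultralimit is \<open>internal_measure\<close>. It has its own name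
  because counting and averaging take place at single indices, before the limit.\<close>

definition dens :: "'b set \<Rightarrow> (nat \<Rightarrow> ('b \<Rightarrow> 'a) set) \<Rightarrow> nat \<Rightarrow> real" where
  "dens A B i = real (card (B i)) / real (card (A \<rightarrow>\<^sub>E X i))"

lemma finite_power: "finite A \<Longrightarrow> finite (A \<rightarrow>\<^sub>E X i)"
  by (simp add: finite_PiE finite_X)

lemma power_nonempty: "(A \<rightarrow>\<^sub>E X i) \<noteq> {}"
  by (simp add: PiE_eq_empty_iff nonempty_X)

lemma card_power_pos: "finite A \<Longrightarrow> 0 < card (A \<rightarrow>\<^sub>E X i)"
  by (simp add: card_gt_0_iff finite_power power_nonempty)

lemma finite_set_seq: "finite A \<Longrightarrow> set_seq X A B \<Longrightarrow> finite (B i)"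
  by (meson finite_power finite_subset set_seq_def)

lemma dens_bounds:
  assumes "finite A" "set_seq X A B"
  shows "dens A B i \<in> {0..1}"
  using assms card_mono[of "A \<rightarrow>\<^sub>E X i" "B i"] card_power_pos[of A i] finite_power[of A i]
  by (auto simp: dens_def set_seq_def divide_le_eq)

lemma dens_tendsto:
  assumes "finite A" "set_seq X A B"
  shows "(dens A B \<longlongrightarrow> internal_measure \<omega> X A B) \<omega>"
  using bounded_tendsto[of "dens A B"] dens_bounds[OF assms]
  by (simp add: internal_measure_def dens_def[abs_def])

lemma internal_measureI:
  "(dens A B \<longlongrightarrow> m) \<omega> \<Longrightarrow> internal_measure \<omega> X A B = m"
  using tendsto_Lim[OF ultra_not_bot] by (simp add: internal_measure_def dens_def[abs_def])

lemma dens_mono: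
  assumes "finite A" "set_seq X A C" "B i \<subseteq> C i"
  shows "dens A B i \<le> dens A C i"
  using assms card_mono[of "C i" "B i"] finite_set_seq[of A C i]
  by (simp add: dens_def divide_right_mono)

lemma internal_measure_nonneg:
  assumes "finite A" "set_seq X A B"
  shows "0 \<le> internal_measure \<omega> X A B"
  using dens_bounds[OF assms]
  by (intro tendsto_lowerbound[OF dens_tendsto[OF assms]] always_eventually)
     (auto simp: ultra_not_bot)

lemma internal_measure_mono:
  assumes "finite A" "set_seq X A B" "set_seq X A C" "eventually (\<lambda>i. B i \<subseteq> C i) \<omega>"
  shows "internal_measure \<omega> X A B \<le> internal_measure \<omega> X A C"
  using assms(4) dens_mono[OF assms(1,3)]
  by (intro tendsto_le[OF ultra_not_bot dens_tendsto dens_tendsto] assms)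
     (auto elim: eventually_mono)

lemma internal_measure_Un_Int:
  assumes "finite A" "set_seq X A B" "set_seq X A C"
  shows "internal_measure \<omega> X A (\<lambda>i. B i \<union> C i) + internal_measure \<omega> X A (\<lambda>i. B i \<inter> C i)
    = internal_measure \<omega> X A B + internal_measure \<omega> X A C" (is "?U + ?I = ?B + ?C")
proof -
  have s: "set_seq X A (\<lambda>i. B i \<union> C i)" "set_seq X A (\<lambda>i. B i \<inter> C i)"
    using assms by (auto simp: set_seq_def)
  have "dens A (\<lambda>i. B i \<union> C i) i + dens A (\<lambda>i. B i \<inter> C i) i = dens A B i + dens A C i" for i
    using card_Un_Int[OF finite_set_seq finite_set_seq, of A B A C i i] assms
    by (simp add: dens_def add_divide_distrib[symmetric] flip: of_nat_add)
  then have "((\<lambda>i. dens A B i + dens A C i) \<longlongrightarrow> ?U + ?I) \<omega>"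
    using tendsto_add[OF dens_tendsto[OF assms(1) s(1)] dens_tendsto[OF assms(1) s(2)]] by simp
  then show ?thesis
    using tendsto_unique[OF ultra_not_bot] tendsto_add[OF dens_tendsto dens_tendsto] assms by blast
qed

lemma internal_measure_empty [simp]: "internal_measure \<omega> X A (\<lambda>i. {}) = 0"
  by (rule internal_measureI) (simp add: dens_def[abs_def])

lemma internal_measure_full: "finite A \<Longrightarrow> internal_measure \<omega> X A (\<lambda>i. A \<rightarrow>\<^sub>E X i) = 1"
  by (intro internal_measureI tendsto_eventually always_eventually)
    (simp add: dens_def card_power_pos less_imp_neq[THEN not_sym])

section \<open>Internal sets\<close>

lemma ultraprodE:
  assumes "c \<in> ultraprod \<omega> X A"
  obtains p where "p \<in> useq X A" "c = uclass \<omega> X A p"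
  using assms by (auto simp: ultraprod_def uclass_def quotient_def)

lemma uclass_in_ultraprod: "p \<in> useq X A \<Longrightarrow> uclass \<omega> X A p \<in> ultraprod \<omega> X A"
  by (auto simp: ultraprod_def uclass_def quotient_def)

text \<open>Two representatives agree at \<open>\<omega>\<close>-most indices, so membership can be
  tested on any of them. This turns the Boolean operations on internal sets into facts about
  \<open>eventually\<close>.\<close>

lemma uclass_in_internal_iff:
  assumes "p \<in> useq X A"
  shows "uclass \<omega> X A p \<in> internal \<omega> X A B \<longleftrightarrow> eventually (\<lambda>i. p i \<in> B i) \<omega>"
proof
  assume "uclass \<omega> X A p \<in> internal \<omega> X A B"
  then obtain q where q: "q \<in> useq X A" "eventually (\<lambda>i. q i \<in> B i) \<omega>"
    "uclass \<omega> X A p = uclass \<omega> X A q" by (auto simp: internal_def)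
  then have "(p, q) \<in> urel \<omega> X A"
    using assms by (auto simp: uclass_def equiv_class_eq_iff[OF equiv_urel])
  then have "eventually (\<lambda>i. p i = q i) \<omega>" by (auto simp: urel_def)
  with q(2) show "eventually (\<lambda>i. p i \<in> B i) \<omega>" by eventually_elim simp
qed (use assms in \<open>auto simp: internal_def\<close>)

lemma internal_subset_ultraprod: "internal \<omega> X A B \<subseteq> ultraprod \<omega> X A"
  by (auto simp: internal_def uclass_in_ultraprod)

lemma ultraprod_subset_eqI:
  assumes "S \<subseteq> ultraprod \<omega> X A" "T \<subseteq> ultraprod \<omega> X A"
    and "\<And>p. p \<in> useq X A \<Longrightarrow> uclass \<omega> X A p \<in> S \<longleftrightarrow> uclass \<omega> X A p \<in> T"
  shows "S = T"
  using assms by (blast elim: ultraprodE)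

lemma internal_Un:
  "internal \<omega> X A (\<lambda>i. B i \<union> C i) = internal \<omega> X A B \<union> internal \<omega> X A C"
  by (rule ultraprod_subset_eqI)
    (use internal_subset_ultraprod in \<open>auto simp: uclass_in_internal_iff eventually_disj_iff\<close>)

lemma internal_Int:
  "internal \<omega> X A (\<lambda>i. B i \<inter> C i) = internal \<omega> X A B \<inter> internal \<omega> X A C"
  by (rule ultraprod_subset_eqI)
    (use internal_subset_ultraprod in \<open>auto simp: uclass_in_internal_iff eventually_conj_iff\<close>)

lemma internal_Diff:
  "internal \<omega> X A (\<lambda>i. B i - C i) = internal \<omega> X A B - internal \<omega> X A C"
  by (rule ultraprod_subset_eqI)
    (use internal_subset_ultraprod in
      \<open>auto simp: uclass_in_internal_iff eventually_conj_iff eventually_not_iff\<close>)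

lemma internal_empty [simp]: "internal \<omega> X A (\<lambda>i. {}) = {}"
  using ultra_not_bot by (simp add: internal_def eventually_False)

lemma internal_full: "internal \<omega> X A (\<lambda>i. A \<rightarrow>\<^sub>E X i) = ultraprod \<omega> X A"
proof (rule ultraprod_subset_eqI)
  fix p assume p: "p \<in> useq X A"
  then have "\<forall>i. p i \<in> A \<rightarrow>\<^sub>E X i" unfolding useq_def by blast
  then show "uclass \<omega> X A p \<in> internal \<omega> X A (\<lambda>i. A \<rightarrow>\<^sub>E X i) \<longleftrightarrow> uclass \<omega> X A p \<in> ultraprod \<omega> X A"
    using p by (simp add: uclass_in_internal_iff uclass_in_ultraprod)
qed (use internal_subset_ultraprod in auto)

text \<open>Where the inclusion fails, choose \<open>p i \<in> B i - C i\<close>; elsewhere any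
  point of the nonempty power serves. If it failed at \<open>\<omega>\<close>-most indices, the
  class of \<open>p\<close> would refute the inclusion of the internal sets.\<close>

lemma internal_subsetD:
  assumes "set_seq X A B" "internal \<omega> X A B \<subseteq> internal \<omega> X A C"
  shows "eventually (\<lambda>i. B i \<subseteq> C i) \<omega>"
proof (rule ccontr)
  assume "\<not> eventually (\<lambda>i. B i \<subseteq> C i) \<omega>"
  then have ev: "eventually (\<lambda>i. \<not> B i \<subseteq> C i) \<omega>" by (simp add: eventually_not_iff)
  have "\<exists>x. x \<in> A \<rightarrow>\<^sub>E X i \<and> (\<not> B i \<subseteq> C i \<longrightarrow> x \<in> B i - C i)" for i
    using assms(1) power_nonempty[of A i] unfolding set_seq_def by (cases "B i \<subseteq> C i") blast+
  then obtain p where p: "\<And>i. p i \<in> A \<rightarrow>\<^sub>E X i" "\<And>i. \<not> B i \<subseteq> C i \<Longrightarrow> p i \<in> B i - C i" by metis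
  have u: "p \<in> useq X A" using p(1) unfolding useq_def by blast
  have "eventually (\<lambda>i. p i \<in> B i - C i) \<omega>" using ev p(2) by (rule eventually_mono)
  then have "uclass \<omega> X A p \<in> internal \<omega> X A B - internal \<omega> X A C"
    unfolding internal_Diff[symmetric] uclass_in_internal_iff[OF u] .
  with assms(2) show False by blast
qed

lemma internal_mono:
  assumes "\<And>i. B i \<subseteq> C i"
  shows "internal \<omega> X A B \<subseteq> internal \<omega> X A C"
proof -
  have "(\<lambda>i. B i \<union> C i) = C" using assms by blast
  then show ?thesis using internal_Un[of A B C] by auto
qed

lemma internal_measure_mono_internal:
  assumes "finite A" "set_seq X A B" "set_seq X A C" "internal \<omega> X A B \<subseteq> internal \<omega> X A C"
  shows "internal_measure \<omega> X A B \<le> internal_measure \<omega> X A C"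
  using assms internal_measure_mono internal_subsetD by blast

section \<open>Null sets and countable covers\<close>

lemma null_set_subset: "null_set \<omega> X A N \<Longrightarrow> M \<subseteq> N \<Longrightarrow> null_set \<omega> X A M"
  unfolding null_set_def by (meson subset_trans)

lemma null_set_Un:
  assumes "finite A" "null_set \<omega> X A M" "null_set \<omega> X A N"
  shows "null_set \<omega> X A (M \<union> N)"
  unfolding null_set_def
proof (intro allI impI)
  fix e :: real assume "0 < e"
  then have "0 < e / 2" by simp
  then obtain B C where B: "set_seq X A B" "M \<subseteq> internal \<omega> X A B" "internal_measure \<omega> X A B \<le> e / 2"
    and C: "set_seq X A C" "N \<subseteq> internal \<omega> X A C" "internal_measure \<omega> X A C \<le> e / 2"
    using assms unfolding null_set_def by meson
  have "set_seq X A (\<lambda>i. B i \<inter> C i)" using B C by (auto simp: set_seq_def)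
  then have "internal_measure \<omega> X A (\<lambda>i. B i \<union> C i) \<le> e"
    using internal_measure_Un_Int[OF assms(1) B(1) C(1)] B(3) C(3)
      internal_measure_nonneg[OF assms(1)] by fastforce
  moreover have "M \<union> N \<subseteq> internal \<omega> X A (\<lambda>i. B i \<union> C i)" "set_seq X A (\<lambda>i. B i \<union> C i)"
    using B C by (auto simp: internal_Un set_seq_def)
  ultimately show "\<exists>B. set_seq X A B \<and> M \<union> N \<subseteq> internal \<omega> X A B \<and> internal_measure \<omega> X A B \<le> e"
    by blast
qed

text \<open>An internal cover has at least the measure of the internal set that it covers, so
  arbitrarily small covers force measure 0.\<close>

lemma null_internal:
  assumes "finite A" "set_seq X A B" "null_set \<omega> X A (internal \<omega> X A B)"
  shows "internal_measure \<omega> X A B = 0"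
proof (rule antisym)
  show "internal_measure \<omega> X A B \<le> 0"
  proof (rule field_le_epsilon)
    fix e :: real assume "0 < e"
    then obtain C where "set_seq X A C" "internal \<omega> X A B \<subseteq> internal \<omega> X A C"
      "internal_measure \<omega> X A C \<le> e" using assms(3) unfolding null_set_def by blast
    with assms show "internal_measure \<omega> X A B \<le> 0 + e"
      using internal_measure_mono_internal[of A B C] by simp
  qed
qed (rule internal_measure_nonneg[OF assms(1,2)])

text \<open>
  The diagonal argument replacing saturation: in coordinate \<open>i\<close> take \<open>F n i\<close> for the largest
  \<open>n \<le> i\<close> up to which all densities are still almost bounded by \<open>m\<close>.
\<close>

lemma internal_cover_increasing:
  assumes "finite A" "\<And>n. set_seq X A (F n)" "\<And>n i. F n i \<subseteq> F (Suc n) i"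
    and "\<And>n. internal_measure \<omega> X A (F n) \<le> m"
  obtains B where "set_seq X A B" "\<And>n. internal \<omega> X A (F n) \<subseteq> internal \<omega> X A B"
    "internal_measure \<omega> X A B \<le> m"
proof -
  define P where "P n i \<longleftrightarrow> n \<le> i \<and> (\<forall>j\<le>n. dens A (F j) i \<le> m + 1 / (real j + 1))" for n i
  define N where "N i = (GREATEST n. P n i)" for i
  define B where "B i = F (N i) i" for i
  have F_mono: "F a i \<subseteq> F b i" if "a \<le> b" for a b i
    using lift_Suc_mono_le[of "\<lambda>n. F n i"] assms(3) that by blast
  have evP: "eventually (P n) \<omega>" for n
  proof -
    have "eventually (\<lambda>i. dens A (F j) i < m + 1 / (real j + 1)) \<omega>" for j
    proof (rule order_tendstoD(2)[OF dens_tendsto[OF assms(1,2)]])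
      show "internal_measure \<omega> X A (F j) < m + 1 / (real j + 1)"
        using assms(4)[of j] by (smt (verit) divide_pos_pos of_nat_0_le_iff)
    qed
    then have "eventually (\<lambda>i. \<forall>j\<in>{..n}. dens A (F j) i < m + 1 / (real j + 1)) \<omega>"
      by (intro eventually_ball_finite) auto
    with eventually_ge[of n] show ?thesis
      by eventually_elim (auto simp: P_def intro: less_imp_le)
  qed
  have N: "n \<le> N i" "P (N i) i" if "P n i" for n i
    using that Greatest_le_nat[of "\<lambda>n. P n i" n i] GreatestI_nat[of "\<lambda>n. P n i" n i]
    by (auto simp: P_def N_def)
  \<comment> \<open>At an index where no \<open>n\<close> satisfies \<open>P n i\<close>, the value
    \<open>N i\<close> is unspecified. Every \<open>F n i\<close> lies in the power, so
    \<open>B\<close> is still a valid sequence there, and by \<open>evP\<close> such indices do not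
    affect the limit.\<close>
  have sB: "set_seq X A B" using assms(2) by (auto simp: set_seq_def B_def)
  have sub: "internal \<omega> X A (F n) \<subseteq> internal \<omega> X A B" for n
  proof
    fix c assume c: "c \<in> internal \<omega> X A (F n)"
    then obtain p where p: "p \<in> useq X A" "c = uclass \<omega> X A p"
      using internal_subset_ultraprod by (blast elim: ultraprodE)
    then have "eventually (\<lambda>i. p i \<in> F n i) \<omega>" using c uclass_in_internal_iff by blast
    with evP[of n] have "eventually (\<lambda>i. p i \<in> B i) \<omega>"
      by eventually_elim (use N F_mono in \<open>unfold B_def, blast\<close>)
    with p show "c \<in> internal \<omega> X A B" using uclass_in_internal_iff by blast
  qed
  \<comment> \<open>The bound in \<open>P\<close> is used at \<open>j = N i\<close>, where the slack
    is at most \<open>1 / (n + 1)\<close> because \<open>n \<le> N i\<close> at most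
    indices.\<close>
  have le: "internal_measure \<omega> X A B \<le> m + 1 / (real n + 1)" for n
  proof (rule tendsto_upperbound[OF dens_tendsto[OF assms(1) sB] _ ultra_not_bot])
    show "eventually (\<lambda>i. dens A B i \<le> m + 1 / (real n + 1)) \<omega>"
      using evP[of n]
    proof eventually_elim
      case (elim i)
      have "dens A B i = dens A (F (N i)) i" by (simp add: dens_def B_def)
      also have "\<dots> \<le> m + 1 / (real (N i) + 1)" using N(2)[OF elim] by (simp add: P_def)
      also have "\<dots> \<le> m + 1 / (real n + 1)" using N(1)[OF elim] by (simp add: frac_le)
      finally show ?case .
    qed
  qed
  have "internal_measure \<omega> X A B \<le> m"
  proof (rule field_le_epsilon)
    fix e :: real assume "0 < e"
    then obtain n where "inverse (real (Suc n)) < e" using reals_Archimedean by blast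
    then have "1 / (real n + 1) < e" by (simp add: inverse_eq_divide add.commute)
    with le[of n] show "internal_measure \<omega> X A B \<le> m + e" by linarith
  qed
  with sB sub that show thesis by blast
qed

lemma null_set_empty: "null_set \<omega> X A {}"
  unfolding null_set_def by (auto intro!: exI[of _ "\<lambda>i. {}"] simp: set_seq_def)

lemma null_set_UN_finite:
  assumes "finite A" "finite J" "\<And>j. j \<in> J \<Longrightarrow> null_set \<omega> X A (N j)"
  shows "null_set \<omega> X A (\<Union>j\<in>J. N j)"
  using assms(2,3) by (induction rule: finite_induct) (auto simp: null_set_empty null_set_Un assms(1))

text \<open>Cover \<open>N n\<close> with measure at most \<open>e / 2 ^ Suc n\<close>. The finite
  partial unions of the covers increase and keep measure at most \<open>e\<close>, so
  \<open>internal_cover_increasing\<close> encloses them all in one internal set of that measure.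
  The countable union of internal sets need not be internal itself.\<close>

lemma null_set_UN:
  fixes N :: "nat \<Rightarrow> (nat \<Rightarrow> 'b \<Rightarrow> 'a) set set"
  assumes A: "finite A" and N: "\<And>n. null_set \<omega> X A (N n)"
  shows "null_set \<omega> X A (\<Union>n. N n)"
  unfolding null_set_def
proof (intro allI impI)
  fix e :: real assume e: "0 < e"
  have "\<exists>B. set_seq X A B \<and> N n \<subseteq> internal \<omega> X A B \<and> internal_measure \<omega> X A B \<le> e / 2 ^ Suc n" for n
    using N[of n] e unfolding null_set_def by simp
  then obtain B where B: "\<And>n. set_seq X A (B n)" "\<And>n. N n \<subseteq> internal \<omega> X A (B n)"
    "\<And>n. internal_measure \<omega> X A (B n) \<le> e / 2 ^ Suc n" by metis
  define F where "F n i = (\<Union>j\<le>n. B j i)" for n i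
  have sF: "set_seq X A (F n)" for n using B(1) by (auto simp: set_seq_def F_def)
  have F_Suc: "F (Suc n) = (\<lambda>i. F n i \<union> B (Suc n) i)" for n
    by (auto simp: F_def fun_eq_iff atMost_Suc)
  have le: "internal_measure \<omega> X A (F n) \<le> e * (1 - 1 / 2 ^ Suc n)" for n
  proof (induction n)
    case 0
    have "F 0 = B 0" by (simp add: F_def fun_eq_iff)
    then show ?case using B(3)[of 0] by simp
  next
    case (Suc n)
    have "set_seq X A (\<lambda>i. F n i \<inter> B (Suc n) i)" using sF B(1) by (auto simp: set_seq_def)
    then have "internal_measure \<omega> X A (F (Suc n))
        \<le> internal_measure \<omega> X A (F n) + internal_measure \<omega> X A (B (Suc n))"
      using internal_measure_Un_Int[OF A sF B(1), of n "Suc n"] internal_measure_nonneg[OF A]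
      unfolding F_Suc by fastforce
    also have "\<dots> \<le> e * (1 - 1 / 2 ^ Suc n) + e / 2 ^ Suc (Suc n)"
      using Suc B(3)[of "Suc n"] by linarith
    also have "\<dots> = e * (1 - 1 / 2 ^ Suc (Suc n))" by (simp add: field_simps)
    finally show ?case .
  qed
  have le': "internal_measure \<omega> X A (F n) \<le> e" for n
  proof -
    have "0 \<le> e / 2 ^ Suc n" using e by simp
    with le[of n] show ?thesis by (simp add: right_diff_distrib)
  qed
  have inc: "F n i \<subseteq> F (Suc n) i" for n i by (auto simp: F_Suc)
  obtain C where C: "set_seq X A C" "\<And>n. internal \<omega> X A (F n) \<subseteq> internal \<omega> X A C"
    "internal_measure \<omega> X A C \<le> e"
    using internal_cover_increasing[of A F e, OF A sF inc le'] by blast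
  have "internal \<omega> X A (B n) \<subseteq> internal \<omega> X A (F n)" for n
    by (rule internal_mono) (auto simp: F_def)
  then have "(\<Union>n. N n) \<subseteq> internal \<omega> X A C" using B(2) C(2) by blast
  with C show "\<exists>B. set_seq X A B \<and> (\<Union>n. N n) \<subseteq> internal \<omega> X A B \<and> internal_measure \<omega> X A B \<le> e"
    by blast
qed

section \<open>Approximation by internal sets\<close>

lemma approximates_internal: "set_seq X A B \<Longrightarrow> approximates \<omega> X A B (internal \<omega> X A B)"
  by (simp add: approximates_def null_set_empty)

lemma internal_measure_Diff:
  assumes "finite A" "set_seq X A B" "set_seq X A C"
  shows "internal_measure \<omega> X A (\<lambda>i. B i - C i) + internal_measure \<omega> X A (\<lambda>i. B i \<inter> C i)
    = internal_measure \<omega> X A B"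
proof -
  have "set_seq X A (\<lambda>i. B i - C i)" "set_seq X A (\<lambda>i. B i \<inter> C i)"
    using assms by (auto simp: set_seq_def)
  moreover have "(\<lambda>i. (B i - C i) \<union> (B i \<inter> C i)) = B" "(\<lambda>i. (B i - C i) \<inter> (B i \<inter> C i)) = (\<lambda>i. {})"
    by auto
  ultimately show ?thesis
    using internal_measure_Un_Int[of A "\<lambda>i. B i - C i" "\<lambda>i. B i \<inter> C i"] assms(1) by simp
qed

text \<open>A point in exactly one of the two internal sets lies in one of the two error sets, so
  both differences are null and both measures equal that of the intersection. Hence the
  \<open>THE\<close> in \<open>mu_value\<close> is well defined.\<close>

lemma approximates_unique:
  assumes A: "finite A" and B: "approximates \<omega> X A B S" and C: "approximates \<omega> X A C S"
  shows "internal_measure \<omega> X A B = internal_measure \<omega> X A C"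
proof -
  have s: "set_seq X A B" "set_seq X A C" "set_seq X A (\<lambda>i. B i - C i)" "set_seq X A (\<lambda>i. C i - B i)"
    using B C unfolding approximates_def set_seq_def by blast+
  have null: "null_set \<omega> X A (((S - internal \<omega> X A B) \<union> (internal \<omega> X A B - S))
      \<union> ((S - internal \<omega> X A C) \<union> (internal \<omega> X A C - S)))"
    using B C null_set_Un[OF A] by (simp add: approximates_def)
  have "null_set \<omega> X A (internal \<omega> X A (\<lambda>i. B i - C i))" "null_set \<omega> X A (internal \<omega> X A (\<lambda>i. C i - B i))"
    unfolding internal_Diff by (rule null_set_subset[OF null], blast)+
  then have "internal_measure \<omega> X A (\<lambda>i. B i - C i) = 0" "internal_measure \<omega> X A (\<lambda>i. C i - B i) = 0"
    using null_internal[OF A] s by blast+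
  then show ?thesis
    using internal_measure_Diff[OF A s(1,2)] internal_measure_Diff[OF A s(2,1)]
    by (simp add: Int_commute)
qed

lemma mu_value_eq:
  assumes "finite A" "approximates \<omega> X A B S"
  shows "mu_value \<omega> X A S = internal_measure \<omega> X A B"
  unfolding mu_value_def using assms approximates_unique by (intro the_equality) blast+

lemma approximates_Compl:
  assumes "approximates \<omega> X A B S" "S \<subseteq> ultraprod \<omega> X A"
  shows "approximates \<omega> X A (\<lambda>i. (A \<rightarrow>\<^sub>E X i) - B i) (ultraprod \<omega> X A - S)"
proof -
  have "null_set \<omega> X A ((S - internal \<omega> X A B) \<union> (internal \<omega> X A B - S))"
    using assms by (simp add: approximates_def)
  then have "null_set \<omega> X A ((ultraprod \<omega> X A - S - (ultraprod \<omega> X A - internal \<omega> X A B))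
      \<union> (ultraprod \<omega> X A - internal \<omega> X A B - (ultraprod \<omega> X A - S)))"
    by (rule null_set_subset) blast
  then show ?thesis unfolding approximates_def internal_Diff internal_full
    by (auto simp: set_seq_def)
qed

lemma approximates_Int:
  assumes A: "finite A" and B: "approximates \<omega> X A B S" and C: "approximates \<omega> X A C T"
  shows "approximates \<omega> X A (\<lambda>i. B i \<inter> C i) (S \<inter> T)"
proof -
  have null: "null_set \<omega> X A (((S - internal \<omega> X A B) \<union> (internal \<omega> X A B - S))
      \<union> ((T - internal \<omega> X A C) \<union> (internal \<omega> X A C - T)))"
    using B C null_set_Un[OF A] by (simp add: approximates_def)
  have "null_set \<omega> X A ((S \<inter> T - internal \<omega> X A (\<lambda>i. B i \<inter> C i))
      \<union> (internal \<omega> X A (\<lambda>i. B i \<inter> C i) - S \<inter> T))"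
    unfolding internal_Int by (rule null_set_subset[OF null]) blast
  moreover have "set_seq X A (\<lambda>i. B i \<inter> C i)" using B by (auto simp: approximates_def set_seq_def)
  ultimately show ?thesis by (simp add: approximates_def)
qed

text \<open>The measures of the partial unions increase to a supremum \<open>m\<close>, and the
  diagonal cover \<open>C\<close> of all of them has measure exactly \<open>m\<close>. What
  \<open>C\<close> has in excess of the union lies in \<open>C\<close> minus the \<open>n\<close>-th
  partial union, whose measure tends to 0. The second conclusion, the limit of the measures, is what
  countable additivity uses.\<close>

lemma approximates_UN:
  fixes B :: "nat \<Rightarrow> nat \<Rightarrow> ('b \<Rightarrow> 'a) set"
  assumes A: "finite A" and B: "\<And>n. approximates \<omega> X A (B n) (S n)"
  obtains C where "approximates \<omega> X A C (\<Union>n. S n)"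
    "(\<lambda>n. internal_measure \<omega> X A (\<lambda>i. \<Union>j\<le>n. B j i)) \<longlonglongrightarrow> internal_measure \<omega> X A C"
proof -
  define F where "F n i = (\<Union>j\<le>n. B j i)" for n i
  define m where "m = (SUP n. internal_measure \<omega> X A (F n))"
  have sB: "set_seq X A (B n)" for n using B by (simp add: approximates_def)
  have sF: "set_seq X A (F n)" for n using sB by (auto simp: set_seq_def F_def)
  have F_Suc: "F (Suc n) = (\<lambda>i. F n i \<union> B (Suc n) i)" for n
    by (auto simp: F_def fun_eq_iff atMost_Suc)
  have inc: "F n i \<subseteq> F (Suc n) i" for n i by (auto simp: F_Suc)
  have bdd: "bdd_above (range (\<lambda>n. internal_measure \<omega> X A (F n)))"
  proof (rule bdd_aboveI2)
    fix n
    show "internal_measure \<omega> X A (F n) \<le> 1"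
      using dens_bounds[OF A sF]
      by (intro tendsto_upperbound[OF dens_tendsto[OF A sF]] always_eventually)
        (auto simp: ultra_not_bot)
  qed
  have le: "internal_measure \<omega> X A (F n) \<le> m" for n
    unfolding m_def by (rule cSUP_upper[OF UNIV_I bdd])
  have incseq: "incseq (\<lambda>n. internal_measure \<omega> X A (F n))"
    using inc by (intro incseq_SucI internal_measure_mono[OF A sF sF] always_eventually) auto
  have lim: "(\<lambda>n. internal_measure \<omega> X A (F n)) \<longlonglongrightarrow> m"
    unfolding m_def by (rule LIMSEQ_incseq_SUP[OF bdd incseq])
  obtain C where C: "set_seq X A C" "\<And>n. internal \<omega> X A (F n) \<subseteq> internal \<omega> X A C"
    "internal_measure \<omega> X A C \<le> m"
    using internal_cover_increasing[of A F m, OF A sF inc le] by blast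
  have eq: "internal_measure \<omega> X A C = m"
  proof (rule antisym[OF C(3)])
    show "m \<le> internal_measure \<omega> X A C"
      unfolding m_def using internal_measure_mono_internal[OF A sF C(1) C(2)]
      by (intro cSUP_least) auto
  qed
  have BF: "internal \<omega> X A (B n) \<subseteq> internal \<omega> X A (F n)" for n
    by (rule internal_mono) (auto simp: F_def)
  have FB: "internal \<omega> X A (F n) \<subseteq> (\<Union>j. internal \<omega> X A (B j))" for n
  proof (induction n)
    case 0
    have "F 0 = B 0" by (simp add: F_def fun_eq_iff)
    then show ?case by auto
  qed (auto simp: F_Suc internal_Un)
  have nullC: "null_set \<omega> X A (internal \<omega> X A C - (\<Union>n. internal \<omega> X A (F n)))"
    unfolding null_set_def
  proof (intro allI impI)
    fix e :: real assume "0 < e"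
    then have "m - e < m" by simp
    obtain n where n: "m - e < internal_measure \<omega> X A (F n)"
      using eventually_happens[OF order_tendstoD(1)[OF lim \<open>m - e < m\<close>]] by auto
    \<comment> \<open>\<open>F n\<close> is contained in \<open>C\<close> as an internal set, hence
      \<open>F n i \<subseteq> C i\<close> only for most \<open>i\<close>. The intersection is
      therefore not literally \<open>F n\<close>, but it has the same measure.\<close>
    have "internal_measure \<omega> X A (F n) = internal_measure \<omega> X A (\<lambda>i. C i \<inter> F n i)"
    proof (rule antisym)
      have "set_seq X A (\<lambda>i. C i \<inter> F n i)" using C(1) by (auto simp: set_seq_def)
      then show "internal_measure \<omega> X A (F n) \<le> internal_measure \<omega> X A (\<lambda>i. C i \<inter> F n i)"
        using C(2)[of n] sF by (intro internal_measure_mono_internal[OF A]) (auto simp: internal_Int)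
      show "internal_measure \<omega> X A (\<lambda>i. C i \<inter> F n i) \<le> internal_measure \<omega> X A (F n)"
        using \<open>set_seq X A (\<lambda>i. C i \<inter> F n i)\<close> sF by (intro internal_measure_mono[OF A]) auto
    qed
    then have "internal_measure \<omega> X A (\<lambda>i. C i - F n i) \<le> e"
      using internal_measure_Diff[OF A C(1) sF, of n] eq n by simp
    moreover have "set_seq X A (\<lambda>i. C i - F n i)" using C(1) by (auto simp: set_seq_def)
    moreover have "internal \<omega> X A C - (\<Union>n. internal \<omega> X A (F n)) \<subseteq> internal \<omega> X A (\<lambda>i. C i - F n i)"
      by (auto simp: internal_Diff)
    ultimately show "\<exists>B. set_seq X A B \<and> internal \<omega> X A C - (\<Union>n. internal \<omega> X A (F n)) \<subseteq> internal \<omega> X A B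
        \<and> internal_measure \<omega> X A B \<le> e" by blast
  qed
  have "null_set \<omega> X A (\<Union>n. (S n - internal \<omega> X A (B n)) \<union> (internal \<omega> X A (B n) - S n))"
    using B by (intro null_set_UN[OF A]) (simp add: approximates_def)
  from null_set_Un[OF A this nullC]
  have "null_set \<omega> X A (((\<Union>n. S n) - internal \<omega> X A C) \<union> (internal \<omega> X A C - (\<Union>n. S n)))"
  proof (rule null_set_subset)
    have eq: "(\<Union>n. internal \<omega> X A (F n)) = (\<Union>j. internal \<omega> X A (B j))" using BF FB by fast
    have sub: "internal \<omega> X A (B j) \<subseteq> internal \<omega> X A C" for j using BF C(2) by (rule subset_trans)
    show "((\<Union>n. S n) - internal \<omega> X A C) \<union> (internal \<omega> X A C - (\<Union>n. S n))
      \<subseteq> (\<Union>n. (S n - internal \<omega> X A (B n)) \<union> (internal \<omega> X A (B n) - S n))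
        \<union> (internal \<omega> X A C - (\<Union>n. internal \<omega> X A (F n)))"
      unfolding eq using sub by blast
  qed
  with C(1) have "approximates \<omega> X A C (\<Union>n. S n)" by (simp add: approximates_def)
  moreover have "F = (\<lambda>n i. \<Union>j\<le>n. B j i)" by (simp add: F_def fun_eq_iff)
  ultimately show thesis using lim eq that[of C] by simp
qed

section \<open>The probability measure on the ultrapower\<close>

lemma sigma_algebra_measurable_sets:
  assumes A: "finite A"
  shows "sigma_algebra (ultraprod \<omega> X A) (measurable_sets \<omega> X A)"
  unfolding sigma_algebra_iff2
proof (intro conjI allI ballI impI)
  show "measurable_sets \<omega> X A \<subseteq> Pow (ultraprod \<omega> X A)" by (auto simp: measurable_sets_def)
  show "{} \<in> measurable_sets \<omega> X A"
    using approximates_internal[of A "\<lambda>i. {}"] by (auto simp: measurable_sets_def set_seq_def)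
next
  fix S assume "S \<in> measurable_sets \<omega> X A"
  then show "ultraprod \<omega> X A - S \<in> measurable_sets \<omega> X A"
    using approximates_Compl by (auto simp: measurable_sets_def)
next
  fix S :: "nat \<Rightarrow> _" assume S: "range S \<subseteq> measurable_sets \<omega> X A"
  then have "\<forall>n. \<exists>B. approximates \<omega> X A B (S n)" by (auto simp: measurable_sets_def)
  then obtain B where B: "\<And>n. approximates \<omega> X A (B n) (S n)" by metis
  obtain C where "approximates \<omega> X A C (\<Union>n. S n)"
    using approximates_UN[of A B S, OF A B] by blast
  with S show "(\<Union>n. S n) \<in> measurable_sets \<omega> X A" by (auto simp: measurable_sets_def)
qed

lemma mu_value_nonneg:
  assumes "finite A" "S \<in> measurable_sets \<omega> X A"
  shows "0 \<le> mu_value \<omega> X A S"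
proof -
  obtain B where B: "approximates \<omega> X A B S" using assms by (auto simp: measurable_sets_def)
  then have "set_seq X A B" by (simp add: approximates_def)
  then show ?thesis using mu_value_eq[OF assms(1) B] internal_measure_nonneg[OF assms(1)] by simp
qed

text \<open>Approximations of disjoint sets meet only inside the error sets, so their intersections
  are null and the measures of partial unions add up exactly. The choice of \<open>C\<close> in
  \<open>approximates_UN\<close> then carries the sum to the limit.\<close>

lemma mu_value_countably_additive:
  assumes A: "finite A"
  shows "countably_additive (measurable_sets \<omega> X A) (\<lambda>S. ennreal (mu_value \<omega> X A S))"
  unfolding countably_additive_def
proof (intro allI impI)
  fix S :: "nat \<Rightarrow> _"
  assume S: "range S \<subseteq> measurable_sets \<omega> X A" "disjoint_family S"
  then have "\<forall>n. \<exists>B. approximates \<omega> X A B (S n)" by (auto simp: measurable_sets_def)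
  then obtain B where B: "\<And>n. approximates \<omega> X A (B n) (S n)" by metis
  obtain C where C: "approximates \<omega> X A C (\<Union>n. S n)"
    "(\<lambda>n. internal_measure \<omega> X A (\<lambda>i. \<Union>j\<le>n. B j i)) \<longlonglongrightarrow> internal_measure \<omega> X A C"
    using approximates_UN[of A B S, OF A B] by blast
  have sB: "set_seq X A (B n)" for n using B by (simp add: approximates_def)
  have disj: "internal_measure \<omega> X A (\<lambda>i. (\<Union>j\<le>n. B j i) \<inter> B (Suc n) i) = 0" for n
  proof -
    have B_int: "internal \<omega> X A (B j) \<inter> internal \<omega> X A (B (Suc n))
       \<subseteq> ((S j - internal \<omega> X A (B j)) \<union> (internal \<omega> X A (B j) - S j))
        \<union> ((S (Suc n) - internal \<omega> X A (B (Suc n))) \<union> (internal \<omega> X A (B (Suc n)) - S (Suc n)))"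
      if "j \<le> n" for j
    proof -
      have "S j \<inter> S (Suc n) = {}"
        using S(2) that by (auto simp: disjoint_family_on_def)
      then show ?thesis by blast
    qed
    have *: "null_set \<omega> X A (internal \<omega> X A (B j) \<inter> internal \<omega> X A (B (Suc n)))" if "j \<le> n" for j
      using null_set_Un[OF A] B by (intro null_set_subset[OF _ B_int[OF that]]) (simp add: approximates_def)
    have "internal \<omega> X A (\<lambda>i. \<Union>j\<le>m. B j i) = (\<Union>j\<le>m. internal \<omega> X A (B j))" for m
      by (induction m) (auto simp: atMost_Suc internal_Un)
    then have "internal \<omega> X A (\<lambda>i. (\<Union>j\<le>n. B j i) \<inter> B (Suc n) i)
        = (\<Union>j\<in>{..n}. internal \<omega> X A (B j) \<inter> internal \<omega> X A (B (Suc n)))"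
      by (auto simp: internal_Int)
    moreover have "null_set \<omega> X A \<dots>" using * by (intro null_set_UN_finite[OF A]) auto
    moreover have "set_seq X A (\<lambda>i. (\<Union>j\<le>n. B j i) \<inter> B (Suc n) i)"
      using sB by (auto simp: set_seq_def)
    ultimately show ?thesis using null_internal[OF A] by simp
  qed
  have "internal_measure \<omega> X A (\<lambda>i. \<Union>j\<le>n. B j i) = (\<Sum>j\<le>n. mu_value \<omega> X A (S j))" for n
  proof (induction n)
    case 0
    then show ?case using mu_value_eq[OF A B] by simp
  next
    case (Suc n)
    have "set_seq X A (\<lambda>i. \<Union>j\<le>n. B j i)" using sB by (auto simp: set_seq_def)
    from internal_measure_Un_Int[OF A this sB, of "Suc n"] show ?case
      using Suc disj mu_value_eq[OF A B] by (simp add: atMost_Suc Un_commute)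
  qed
  \<comment> \<open>The partial unions run over \<open>j \<le> n\<close> inclusively, hence
    \<open>sums_def_le\<close>.\<close>
  with C have "(\<lambda>n. mu_value \<omega> X A (S n)) sums mu_value \<omega> X A (\<Union>n. S n)"
    unfolding sums_def_le using mu_value_eq[OF A C(1)] by simp
  then show "(\<Sum>n. ennreal (mu_value \<omega> X A (S n))) = ennreal (mu_value \<omega> X A (\<Union>n. S n))"
    using S(1) mu_value_nonneg[OF A] by (intro suminf_ennreal_eq) auto
qed

lemma space_mu [simp]: "finite A \<Longrightarrow> space (mu \<omega> X A) = ultraprod \<omega> X A"
  unfolding mu_def by (rule space_measure_of) (auto simp: measurable_sets_def)

lemma sets_mu [simp]: "finite A \<Longrightarrow> sets (mu \<omega> X A) = measurable_sets \<omega> X A"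
  unfolding mu_def by (rule sigma_algebra.sets_measure_of_eq[OF sigma_algebra_measurable_sets])

lemma emeasure_mu:
  assumes A: "finite A" and S: "S \<in> measurable_sets \<omega> X A"
  shows "emeasure (mu \<omega> X A) S = ennreal (mu_value \<omega> X A S)"
  unfolding mu_def
proof (rule emeasure_measure_of_sigma[OF sigma_algebra_measurable_sets[OF A] _ _ S])
  have "approximates \<omega> X A (\<lambda>i. {}) {}"
    using approximates_internal[of A "\<lambda>i. {}"] by (simp add: set_seq_def)
  then show "positive (measurable_sets \<omega> X A) (\<lambda>S. ennreal (mu_value \<omega> X A S))"
    using mu_value_eq[OF A] by (auto simp: positive_def)
qed (rule mu_value_countably_additive[OF A])

lemma measure_mu:
  assumes "finite A" "approximates \<omega> X A B S" "S \<subseteq> ultraprod \<omega> X A"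
  shows "measure (mu \<omega> X A) S = internal_measure \<omega> X A B"
proof -
  have S: "S \<in> measurable_sets \<omega> X A" using assms by (auto simp: measurable_sets_def)
  show ?thesis
    using emeasure_mu[OF assms(1) S] mu_value_nonneg[OF assms(1) S] mu_value_eq[OF assms(1,2)]
    by (simp add: measure_def)
qed

lemma prob_space_mu:
  assumes A: "finite A" shows "prob_space (mu \<omega> X A)"
proof
  have a: "approximates \<omega> X A (\<lambda>i. A \<rightarrow>\<^sub>E X i) (ultraprod \<omega> X A)"
    using approximates_internal[of A "\<lambda>i. A \<rightarrow>\<^sub>E X i"] by (simp add: internal_full set_seq_def)
  then have "ultraprod \<omega> X A \<in> measurable_sets \<omega> X A" by (auto simp: measurable_sets_def)
  then show "emeasure (mu \<omega> X A) (space (mu \<omega> X A)) = 1"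
    using emeasure_mu[OF A] mu_value_eq[OF A a] internal_measure_full[OF A] A by simp
qed

section \<open>Cylinders and the sigma-algebras of projections\<close>

text \<open>The finite-stage counterpart of the preimage under \<open>uproj\<close>; the two are
  matched in \<open>internal_cyl\<close>.\<close>

definition cyl :: "'b set \<Rightarrow> 'b set \<Rightarrow> (nat \<Rightarrow> ('b \<Rightarrow> 'a) set) \<Rightarrow> nat \<Rightarrow> ('b \<Rightarrow> 'a) set" where
  "cyl K A B i = {p \<in> K \<rightarrow>\<^sub>E X i. restrict p A \<in> B i}"

lemma set_seq_cyl: "set_seq X K (cyl K A B)"
  by (auto simp: set_seq_def cyl_def)

text \<open>Restricting a point to \<open>A\<close> and to \<open>K - A\<close> injects the cylinder
  into a product with base \<open>B i\<close>. The bound is what pulls null sets back along the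
  projection.\<close>

lemma dens_cyl_le:
  assumes K: "finite K" and AK: "A \<subseteq> K" and B: "set_seq X A B"
  shows "dens K (cyl K A B) i \<le> dens A B i"
proof -
  have fin: "finite A" "finite (K - A)" using K AK finite_subset by auto
  have "card (cyl K A B i) \<le> card (B i \<times> ((K - A) \<rightarrow>\<^sub>E X i))"
  proof (rule card_inj_on_le)
    show "inj_on (\<lambda>p. (restrict p A, restrict p (K - A))) (cyl K A B i)"
    proof (rule inj_onI)
      fix p q assume pq: "p \<in> cyl K A B i" "q \<in> cyl K A B i"
        "(restrict p A, restrict p (K - A)) = (restrict q A, restrict q (K - A))"
      show "p = q"
      proof (rule PiE_ext)
        show "p \<in> K \<rightarrow>\<^sub>E X i" "q \<in> K \<rightarrow>\<^sub>E X i" using pq by (auto simp: cyl_def)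
        fix j assume "j \<in> K"
        then show "p j = q j" using pq(3) by (metis DiffI prod.inject restrict_apply')
      qed
    qed
    show "(\<lambda>p. (restrict p A, restrict p (K - A))) ` cyl K A B i \<subseteq> B i \<times> ((K - A) \<rightarrow>\<^sub>E X i)"
      by (auto simp: cyl_def)
    show "finite (B i \<times> ((K - A) \<rightarrow>\<^sub>E X i))"
      using finite_set_seq[OF fin(1) B] finite_power[OF fin(2)] by simp
  qed
  then have le: "card (cyl K A B i) \<le> card (B i) * card ((K - A) \<rightarrow>\<^sub>E X i)"
    by (simp add: card_cartesian_product)
  have "card (K \<rightarrow>\<^sub>E X i) = card (A \<rightarrow>\<^sub>E X i) * card ((K - A) \<rightarrow>\<^sub>E X i)"
    using K fin AK card_mono[OF K AK]
    by (simp add: card_PiE card_Diff_subset flip: power_add)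
  then have "dens K (cyl K A B) i
      \<le> real (card (B i) * card ((K - A) \<rightarrow>\<^sub>E X i)) / real (card (A \<rightarrow>\<^sub>E X i) * card ((K - A) \<rightarrow>\<^sub>E X i))"
    unfolding dens_def using le by (metis divide_right_mono of_nat_0_le_iff of_nat_le_iff)
  also have "\<dots> = dens A B i"
    using card_power_pos[OF fin(2), of i] by (simp add: dens_def)
  finally show ?thesis .
qed

lemma uproj_in_ultraprod:
  assumes "A \<subseteq> K"
  shows "uproj \<omega> X A \<in> ultraprod \<omega> X K \<rightarrow> ultraprod \<omega> X A"
proof
  fix c assume "c \<in> ultraprod \<omega> X K"
  then obtain p where "p \<in> useq X K" "c = uclass \<omega> X K p" by (rule ultraprodE)
  then show "uproj \<omega> X A c \<in> ultraprod \<omega> X A"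
    using assms by (simp add: uproj_uclass restrict_useq uclass_in_ultraprod)
qed

lemma internal_cyl:
  assumes "A \<subseteq> K"
  shows "internal \<omega> X K (cyl K A B) = uproj \<omega> X A -` internal \<omega> X A B \<inter> ultraprod \<omega> X K"
proof (rule ultraprod_subset_eqI)
  fix p assume p: "p \<in> useq X K"
  then have "\<forall>i. p i \<in> K \<rightarrow>\<^sub>E X i" unfolding useq_def by blast
  then show "uclass \<omega> X K p \<in> internal \<omega> X K (cyl K A B) \<longleftrightarrow>
      uclass \<omega> X K p \<in> uproj \<omega> X A -` internal \<omega> X A B \<inter> ultraprod \<omega> X K"
    using p assms
    by (simp add: uproj_uclass uclass_in_internal_iff restrict_useq uclass_in_ultraprod cyl_def)
qed (use internal_subset_ultraprod in auto)

text \<open>The error set of the preimage is the preimage of the error set \<open>?D\<close>. A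
  small cover \<open>C\<close> of \<open>?D\<close> pulls back to \<open>cyl K A C\<close>, whose
  measure is no larger by \<open>dens_cyl_le\<close>.\<close>

lemma approximates_cyl:
  assumes K: "finite K" and AK: "A \<subseteq> K" and B: "approximates \<omega> X A B S"
  shows "approximates \<omega> X K (cyl K A B) (uproj \<omega> X A -` S \<inter> ultraprod \<omega> X K)"
  unfolding approximates_def
proof
  have A: "finite A" using K AK finite_subset by auto
  let ?D = "(S - internal \<omega> X A B) \<union> (internal \<omega> X A B - S)"
  show "null_set \<omega> X K ((uproj \<omega> X A -` S \<inter> ultraprod \<omega> X K - internal \<omega> X K (cyl K A B)) \<union>
      (internal \<omega> X K (cyl K A B) - (uproj \<omega> X A -` S \<inter> ultraprod \<omega> X K)))"
    unfolding null_set_def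
  proof (intro allI impI)
    fix e :: real assume "0 < e"
    then obtain C where C: "set_seq X A C" "?D \<subseteq> internal \<omega> X A C" "internal_measure \<omega> X A C \<le> e"
      using B unfolding approximates_def null_set_def by blast
    have "internal_measure \<omega> X K (cyl K A C) \<le> internal_measure \<omega> X A C"
      by (rule tendsto_le[OF ultra_not_bot dens_tendsto[OF A C(1)] dens_tendsto[OF K set_seq_cyl]])
        (simp add: dens_cyl_le[OF K AK C(1)])
    moreover have "(uproj \<omega> X A -` S \<inter> ultraprod \<omega> X K - internal \<omega> X K (cyl K A B)) \<union>
      (internal \<omega> X K (cyl K A B) - (uproj \<omega> X A -` S \<inter> ultraprod \<omega> X K)) \<subseteq> internal \<omega> X K (cyl K A C)"
      unfolding internal_cyl[OF AK] using C(2) by blast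
    ultimately show "\<exists>C. set_seq X K C \<and>
      (uproj \<omega> X A -` S \<inter> ultraprod \<omega> X K - internal \<omega> X K (cyl K A B)) \<union>
      (internal \<omega> X K (cyl K A B) - (uproj \<omega> X A -` S \<inter> ultraprod \<omega> X K)) \<subseteq> internal \<omega> X K C \<and>
      internal_measure \<omega> X K C \<le> e"
      using set_seq_cyl C(3) by (intro exI[of _ "cyl K A C"]) auto
  qed
qed (rule set_seq_cyl)

lemma sets_sigma_alg:
  assumes "finite K" "A \<subseteq> K"
  shows "sets (sigma_alg \<omega> X K A)
    = {uproj \<omega> X A -` S \<inter> ultraprod \<omega> X K | S. S \<in> measurable_sets \<omega> X A}"
proof -
  have "finite A" using assms finite_subset by auto
  then show ?thesis
    using uproj_in_ultraprod[OF assms(2)]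
    by (simp add: sigma_alg_def sets_vimage_algebra2)
qed

text \<open>Trades a set of the sigma-algebra for a sequence of finite cylinders, to which counting
  applies.\<close>

lemma sigma_alg_approximates_cyl:
  assumes "finite K" "A \<subseteq> K" "T \<in> sets (sigma_alg \<omega> X K A)"
  obtains B where "set_seq X A B" "approximates \<omega> X K (cyl K A B) T" "T \<subseteq> ultraprod \<omega> X K"
proof -
  obtain S B where S: "T = uproj \<omega> X A -` S \<inter> ultraprod \<omega> X K" "approximates \<omega> X A B S"
    using assms sets_sigma_alg[OF assms(1,2)] by (auto simp: measurable_sets_def)
  with that[of B] approximates_cyl[OF assms(1,2) S(2)] show thesis
    by (simp add: approximates_def)
qed

lemma internal_cyl_in_sigma_alg:
  assumes "finite K" "A \<subseteq> K" "set_seq X A B"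
  shows "internal \<omega> X K (cyl K A B) \<in> sets (sigma_alg \<omega> X K A)"
proof -
  have "internal \<omega> X A B \<in> measurable_sets \<omega> X A"
    using approximates_internal[OF assms(3)] internal_subset_ultraprod
    unfolding measurable_sets_def by blast
  then show ?thesis unfolding internal_cyl[OF assms(2)] sets_sigma_alg[OF assms(1,2)] by blast
qed

lemma sigma_alg_subset_mu:
  assumes "finite K" "A \<subseteq> K"
  shows "sets (sigma_alg \<omega> X K A) \<subseteq> sets (mu \<omega> X K)"
proof
  fix T assume "T \<in> sets (sigma_alg \<omega> X K A)"
  from sigma_alg_approximates_cyl[OF assms this] obtain B where
    "approximates \<omega> X K (cyl K A B) T" "T \<subseteq> ultraprod \<omega> X K" .
  then show "T \<in> sets (mu \<omega> X K)" using assms(1) by (auto simp: measurable_sets_def)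
qed

section \<open>Independence from the lower-order sigma-algebra\<close>

lemma star_generators_subset:
  assumes "finite K" "A \<subseteq> K"
  shows "(\<Union>B\<in>{B. B \<subseteq> A \<and> card B = card A - 1}. sets (sigma_alg \<omega> X K B)) \<subseteq> sets (mu \<omega> X K)"
  using sigma_alg_subset_mu[OF assms(1)] assms(2) by blast

lemma sets_sigma_alg_star:
  assumes "finite K" "A \<subseteq> K"
  shows "sets (sigma_alg_star \<omega> X K A) = sigma_sets (ultraprod \<omega> X K)
    (\<Union>B\<in>{B. B \<subseteq> A \<and> card B = card A - 1}. sets (sigma_alg \<omega> X K B))"
  unfolding sigma_alg_star_def
  using star_generators_subset[OF assms] sets.sets_into_space[of _ "mu \<omega> X K"] assms(1)
  by (intro sets_measure_of) auto

text \<open>This makes \<open>real_cond_exp\<close> with respect to \<open>sigma_alg_star\<close> a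
  genuine conditional expectation, so that its defining integral identity is available.\<close>

lemma subalgebra_star:
  assumes "finite K" "A \<subseteq> K"
  shows "subalgebra (mu \<omega> X K) (sigma_alg_star \<omega> X K A)"
  unfolding subalgebra_def
proof
  show "space (sigma_alg_star \<omega> X K A) = space (mu \<omega> X K)"
    using assms(1) unfolding sigma_alg_star_def by (simp add: space_measure_of_conv)
  show "sets (sigma_alg_star \<omega> X K A) \<subseteq> sets (mu \<omega> X K)"
    using sets.sigma_sets_subset[OF star_generators_subset[OF assms]] assms
    by (simp add: sets_sigma_alg_star)
qed

text \<open>Integrating the constant conditional expectation over \<open>E\<close> gives
  \<open>c\<close> times the measure of \<open>E\<close>. Taking \<open>E\<close> to be the whole
  space identifies \<open>c\<close> as the measure of \<open>S\<close>.\<close>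

lemma measure_Int_star:
  assumes K: "finite K" and AK: "A \<subseteq> K" and S: "S \<in> sets (mu \<omega> X K)"
    and c: "AE x in mu \<omega> X K. real_cond_exp (mu \<omega> X K) (sigma_alg_star \<omega> X K A) (indicator S) x = c"
    and D: "D \<in> sets (sigma_alg_star \<omega> X K A)"
  shows "measure (mu \<omega> X K) (S \<inter> D) = measure (mu \<omega> X K) S * measure (mu \<omega> X K) D"
proof -
  let ?M = "mu \<omega> X K" and ?F = "sigma_alg_star \<omega> X K A"
  interpret prob_space ?M by (rule prob_space_mu[OF K])
  interpret F: finite_measure_subalgebra ?M ?F
    by unfold_locales (rule subalgebra_star[OF K AK])
  have *: "measure ?M (S \<inter> E) = c * measure ?M E" if E: "E \<in> sets ?F" for E
  proof -
    have EM: "E \<in> sets ?M" using E subalgebra_star[OF K AK] by (auto simp: subalgebra_def)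
    have "measure ?M (S \<inter> E) = (\<integral>x. indicator (S \<inter> E) x \<partial>?M)"
      using S EM by (simp add: sets.Int_space_eq2)
    also have "\<dots> = (\<integral>x\<in>E. indicator S x \<partial>?M)"
      unfolding set_lebesgue_integral_def
      by (intro Bochner_Integration.integral_cong) (auto simp: indicator_def)
    also have "\<dots> = (\<integral>x\<in>E. real_cond_exp ?M ?F (indicator S) x \<partial>?M)"
      using S by (intro F.real_cond_exp_intA[OF _ E]) (simp add: integrable_real_indicator emeasure_eq_measure)
    also have "\<dots> = (\<integral>x. c * indicator E x \<partial>?M)"
      unfolding set_lebesgue_integral_def
      by (intro integral_cong_AE) (use c EM in auto)
    also have "\<dots> = c * measure ?M E" using EM by (simp add: sets.Int_space_eq2)
    finally show ?thesis .
  qed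
  have "space ?M \<in> sets ?F" using sets.top[of ?F] F.subalg unfolding subalgebra_def by metis
  from *[OF this] have "c = measure ?M S" using S prob_space sets.sets_into_space[OF S] by (simp add: Int_absorb2)
  with *[OF D] show ?thesis by simp
qed

text \<open>Finiteness of \<open>J\<close> lets \<open>eventually\<close> pass through the
  quantifier over \<open>J\<close>. The explicit intersection with \<open>ultraprod\<close> makes
  the case \<open>J = {}\<close> give the whole space rather than \<open>UNIV\<close>.\<close>

lemma internal_INT:
  assumes "finite J"
  shows "internal \<omega> X K (\<lambda>i. {p \<in> K \<rightarrow>\<^sub>E X i. \<forall>j\<in>J. p \<in> D j i})
    = ultraprod \<omega> X K \<inter> (\<Inter>j\<in>J. internal \<omega> X K (D j))"
proof (rule ultraprod_subset_eqI)
  fix p assume p: "p \<in> useq X K"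
  then have "\<forall>i. p i \<in> K \<rightarrow>\<^sub>E X i" unfolding useq_def by blast
  then show "uclass \<omega> X K p \<in> internal \<omega> X K (\<lambda>i. {p \<in> K \<rightarrow>\<^sub>E X i. \<forall>j\<in>J. p \<in> D j i}) \<longleftrightarrow>
      uclass \<omega> X K p \<in> ultraprod \<omega> X K \<inter> (\<Inter>j\<in>J. internal \<omega> X K (D j))"
    using p by (simp add: uclass_in_internal_iff uclass_in_ultraprod eventually_ball_finite_distrib[OF assms])
qed (use internal_subset_ultraprod in auto)

lemma approximates_INT:
  assumes K: "finite K" and J: "finite J" and D: "\<And>j. j \<in> J \<Longrightarrow> approximates \<omega> X K (D j) (S j)"
  shows "approximates \<omega> X K (\<lambda>i. {p \<in> K \<rightarrow>\<^sub>E X i. \<forall>j\<in>J. p \<in> D j i}) (ultraprod \<omega> X K \<inter> (\<Inter>j\<in>J. S j))"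
proof -
  have "null_set \<omega> X K (\<Union>j\<in>J. (S j - internal \<omega> X K (D j)) \<union> (internal \<omega> X K (D j) - S j))"
    using D by (intro null_set_UN_finite[OF K J]) (simp add: approximates_def)
  then show ?thesis
    unfolding approximates_def internal_INT[OF J]
    by (auto simp: set_seq_def elim: null_set_subset)
qed

text \<open>Each cylinder over \<open>C j\<close> is a generator of \<open>sigma_alg_star\<close>,
  so the internal set of \<open>W\<close> belongs to it. Independence of \<open>S\<close> from that
  set, read off the approximations \<open>T\<close> and \<open>W\<close>, is the asserted limit of
  densities.\<close>

lemma dens_Int_star_tendsto:
  assumes K: "finite K" and AK: "A \<subseteq> K" and J: "finite J"
    and T: "approximates \<omega> X K T S" "S \<subseteq> ultraprod \<omega> X K"
    and c: "AE x in mu \<omega> X K. real_cond_exp (mu \<omega> X K) (sigma_alg_star \<omega> X K A) (indicator S) x = c"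
    and C: "\<And>j. j \<in> J \<Longrightarrow> C j \<subseteq> A \<and> card (C j) = card A - 1"
    and E: "\<And>j. j \<in> J \<Longrightarrow> set_seq X (C j) (E j)"
    and W: "\<And>i. W i = {p \<in> K \<rightarrow>\<^sub>E X i. \<forall>j\<in>J. p \<in> cyl K (C j) (E j) i}"
  shows "((\<lambda>i. dens K (\<lambda>i. T i \<inter> W i) i - dens K T i * dens K W i) \<longlongrightarrow> 0) \<omega>"
proof -
  have W': "W = (\<lambda>i. {p \<in> K \<rightarrow>\<^sub>E X i. \<forall>j\<in>J. p \<in> cyl K (C j) (E j) i})" using W by (simp add: fun_eq_iff)
  have sW: "set_seq X K W" by (auto simp: set_seq_def W)
  have sT: "set_seq X K T" using T by (simp add: approximates_def)
  have S: "S \<in> sets (mu \<omega> X K)" using T K by (auto simp: measurable_sets_def)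
  let ?F = "sigma_alg_star \<omega> X K A"
  have top: "ultraprod \<omega> X K \<in> sets ?F"
    using sets.top[of ?F] subalgebra_star[OF K AK] K unfolding subalgebra_def by (metis space_mu)
  have gen: "internal \<omega> X K (cyl K (C j) (E j)) \<in> sets ?F" if "j \<in> J" for j
  proof -
    have "internal \<omega> X K (cyl K (C j) (E j)) \<in> sets (sigma_alg \<omega> X K (C j))"
      using C[OF that] E[OF that] AK by (intro internal_cyl_in_sigma_alg[OF K]) auto
    then show ?thesis
      using C[OF that] unfolding sets_sigma_alg_star[OF K AK] by (intro sigma_sets.Basic) auto
  qed
  have D: "internal \<omega> X K W \<in> sets ?F"
    unfolding W' internal_INT[OF J]
  proof (cases "J = {}")
    case False
    with gen J show "ultraprod \<omega> X K \<inter> (\<Inter>j\<in>J. internal \<omega> X K (cyl K (C j) (E j))) \<in> sets ?F"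
      by (intro sets.Int[OF top] sets.finite_INT) auto
  qed (use top in simp)
  have aW: "approximates \<omega> X K W (internal \<omega> X K W)" by (rule approximates_internal[OF sW])
  have aI: "approximates \<omega> X K (\<lambda>i. T i \<inter> W i) (S \<inter> internal \<omega> X K W)"
    by (rule approximates_Int[OF K T(1) aW])
  have sI: "set_seq X K (\<lambda>i. T i \<inter> W i)" using sW by (auto simp: set_seq_def)
  have "S \<inter> internal \<omega> X K W \<subseteq> ultraprod \<omega> X K" using T(2) by blast
  then have "internal_measure \<omega> X K (\<lambda>i. T i \<inter> W i) = internal_measure \<omega> X K T * internal_measure \<omega> X K W"
    using measure_Int_star[OF K AK S c D] measure_mu[OF K T] measure_mu[OF K aW internal_subset_ultraprod]
      measure_mu[OF K aI] by simp
  then show ?thesis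
    using tendsto_diff[OF dens_tendsto[OF K sI] tendsto_mult[OF dens_tendsto[OF K sT] dens_tendsto[OF K sW]]]
    by simp
qed

section \<open>Averaging over frozen coordinates\<close>

text \<open>By \<open>card_splice_on\<close> the densities of \<open>T i \<inter> W i\<close> and of
  \<open>W i\<close> are means over \<open>y\<close> of section densities, and \<open>T i\<close> is
  its own section by \<open>TA\<close>. So the left-hand difference is the mean of the quantities
  \<open>g y\<close>, and a \<open>y\<close> maximising \<open>\<bar>g y\<bar>\<close> dominates
  it.\<close>

lemma dens_diff_splice_bound:
  assumes K: "finite K" and T: "T i \<subseteq> K \<rightarrow>\<^sub>E X i" and W: "W i \<subseteq> K \<rightarrow>\<^sub>E X i"
    and TA: "\<And>x y. x \<in> K \<rightarrow>\<^sub>E X i \<Longrightarrow> y \<in> K \<rightarrow>\<^sub>E X i \<Longrightarrow> splice_on K A x y \<in> T i \<longleftrightarrow> x \<in> T i"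
  obtains y where "y \<in> K \<rightarrow>\<^sub>E X i"
    "\<bar>dens K (\<lambda>i. T i \<inter> W i) i - dens K T i * dens K W i\<bar>
      \<le> \<bar>dens K (\<lambda>i. T i \<inter> {x \<in> K \<rightarrow>\<^sub>E X i. splice_on K A x y \<in> W i}) i
          - dens K T i * dens K (\<lambda>i. {x \<in> K \<rightarrow>\<^sub>E X i. splice_on K A x y \<in> W i}) i\<bar>"
proof -
  let ?P = "K \<rightarrow>\<^sub>E X i"
  let ?D = "\<lambda>y. {x \<in> ?P. splice_on K A x y \<in> W i}"
  let ?n = "real (card ?P)"
  define g where "g y = real (card (T i \<inter> ?D y)) / ?n - real (card (T i)) / ?n * (real (card (?D y)) / ?n)" for y
  have fin: "finite ?P" by (rule finite_power[OF K])
  have n: "?n > 0" using card_power_pos[OF K] by simp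
  have "finite ((\<lambda>y. \<bar>g y\<bar>) ` ?P)" "(\<lambda>y. \<bar>g y\<bar>) ` ?P \<noteq> {}" using fin power_nonempty[of K i] by auto
  then have "Max ((\<lambda>y. \<bar>g y\<bar>) ` ?P) \<in> (\<lambda>y. \<bar>g y\<bar>) ` ?P" "\<And>y. y \<in> ?P \<Longrightarrow> \<bar>g y\<bar> \<le> Max ((\<lambda>y. \<bar>g y\<bar>) ` ?P)"
    by (auto intro: Max_in Max_ge)
  then obtain y where y: "y \<in> ?P" "\<And>z. z \<in> ?P \<Longrightarrow> \<bar>g z\<bar> \<le> \<bar>g y\<bar>" by fastforce
  have "{x \<in> ?P. splice_on K A x z \<in> T i \<inter> W i} = T i \<inter> ?D z" if "z \<in> ?P" for z
    using TA that T by auto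
  then have "card ?P * card (T i \<inter> W i) = (\<Sum>z\<in>?P. card (T i \<inter> ?D z))"
    using card_splice_on[OF fin, of "T i \<inter> W i" A] T by (simp add: le_infI1)
  then have 1: "?n * real (card (T i \<inter> W i)) = (\<Sum>z\<in>?P. real (card (T i \<inter> ?D z)))"
    by (metis (no_types, lifting) of_nat_mult of_nat_sum sum.cong)
  have 2: "?n * real (card (W i)) = (\<Sum>z\<in>?P. real (card (?D z)))"
    using card_splice_on[OF fin W, of A] by (metis (no_types, lifting) of_nat_mult of_nat_sum sum.cong)
  \<comment> \<open>The factor belonging to \<open>T i\<close> does not depend on \<open>z\<close>,
    so it leaves the sum and only the section counts are averaged.\<close>
  have "(\<Sum>z\<in>?P. g z) = (?n * real (card (T i \<inter> W i))) / ?n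
      - real (card (T i)) / ?n * ((?n * real (card (W i))) / ?n)"
    unfolding g_def 1 2 by (simp add: sum_subtractf sum_divide_distrib sum_distrib_left)
  then have "?n * (dens K (\<lambda>i. T i \<inter> W i) i - dens K T i * dens K W i) = (\<Sum>z\<in>?P. g z)"
    using n by (simp add: dens_def right_diff_distrib)
  then have "?n * \<bar>dens K (\<lambda>i. T i \<inter> W i) i - dens K T i * dens K W i\<bar> = \<bar>\<Sum>z\<in>?P. g z\<bar>"
    using n by (metis abs_mult abs_of_pos)
  also have "\<dots> \<le> (\<Sum>z\<in>?P. \<bar>g z\<bar>)" by (rule sum_abs)
  also have "\<dots> \<le> ?n * \<bar>g y\<bar>" using sum_bounded_above[of ?P "\<lambda>z. \<bar>g z\<bar>" "\<bar>g y\<bar>"] y(2) by simp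
  finally have "\<bar>dens K (\<lambda>i. T i \<inter> W i) i - dens K T i * dens K W i\<bar> \<le> \<bar>g y\<bar>" using n by simp
  then show thesis using that[OF y(1)] by (simp add: g_def dens_def)
qed

text \<open>On \<open>B\<close> the splice depends on \<open>x\<close> only through the coordinates
  in \<open>B \<inter> A\<close>, hence only through \<open>restrict x C\<close>. The section is
  therefore the cylinder over its own projection to \<open>C\<close>.\<close>

lemma cyl_splice_on:
  assumes C: "B \<inter> A \<subseteq> C" "C \<subseteq> K" and BK: "B \<subseteq> K"
  shows "{x \<in> K \<rightarrow>\<^sub>E X i. splice_on K A x (y i) \<in> cyl K B D i}
    = cyl K C (\<lambda>i. (\<lambda>x. restrict x C) ` {x \<in> K \<rightarrow>\<^sub>E X i. splice_on K A x (y i) \<in> cyl K B D i}) i"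
proof (intro equalityI subsetI)
  fix x assume "x \<in> cyl K C (\<lambda>i. (\<lambda>x. restrict x C) `
    {x \<in> K \<rightarrow>\<^sub>E X i. splice_on K A x (y i) \<in> cyl K B D i}) i"
  then obtain x' where x: "x \<in> K \<rightarrow>\<^sub>E X i" "restrict x C = restrict x' C" "x' \<in> K \<rightarrow>\<^sub>E X i"
    and x': "splice_on K A x' (y i) \<in> cyl K B D i"
    by (auto simp: cyl_def)
  have "restrict (splice_on K A x (y i)) B = restrict (splice_on K A x' (y i)) B"
  proof (rule restrict_ext)
    fix j assume j: "j \<in> B"
    have "x j = x' j" if "j \<in> A" using x(2) that j C by (metis IntI restrict_apply' subsetD)
    then show "splice_on K A x (y i) j = splice_on K A x' (y i) j" by (simp add: splice_on_def)
  qed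
  \<comment> \<open>No assumption places \<open>y i\<close> in the power. Its values on
    \<open>K - A\<close> lie in \<open>X i\<close> because they also occur in the splice with
    \<open>x'\<close>.\<close>
  moreover have "splice_on K A x (y i) \<in> K \<rightarrow>\<^sub>E X i"
  proof (rule PiE_I)
    fix j assume "j \<in> K"
    then have "splice_on K A x' (y i) j \<in> X i" using x' by (auto simp: cyl_def)
    with \<open>j \<in> K\<close> x(1) show "splice_on K A x (y i) j \<in> X i" by (auto simp: splice_on_def)
  qed (simp add: splice_on_def)
  ultimately show "x \<in> {x \<in> K \<rightarrow>\<^sub>E X i. splice_on K A x (y i) \<in> cyl K B D i}"
    using x x' by (auto simp: cyl_def)
qed (auto simp: cyl_def)

text \<open>The generators of \<open>sigma_alg_star\<close> have exactly one element less than
  \<open>A\<close>, whereas the intersections that arise may be smaller and have to be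
  enlarged.\<close>

lemma exists_card_pred_superset:
  assumes "finite A" "C \<subset> A"
  obtains C' where "C \<subseteq> C'" "C' \<subseteq> A" "card C' = card A - 1"
proof -
  obtain a where "a \<in> A" "a \<notin> C" using assms by blast
  with assms show thesis by (intro that[of "A - {a}"]) (auto simp: card_Diff_singleton)
qed

section \<open>Induction over the sets by cardinality\<close>

text \<open>The ranking induction inserts indices so that the new \<open>A r\<close> has maximal
  cardinality among those present. The cylinder over it then decouples from the intersection
  \<open>W\<close> of the others, and the induction hypothesis gives the limit for
  \<open>W\<close>.\<close>

lemma dens_INT_tendsto:
  assumes K: "finite K" and I: "finite I" and inj: "inj_on A I"
    and AK: "\<And>i. i \<in> I \<Longrightarrow> A i \<subseteq> K"
    and B: "\<And>i. i \<in> I \<Longrightarrow> approximates \<omega> X K (cyl K (A i) (B i)) (S i)" "\<And>i. i \<in> I \<Longrightarrow> S i \<subseteq> ultraprod \<omega> X K"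
    and c: "\<And>i. i \<in> I \<Longrightarrow> \<exists>c. AE x in mu \<omega> X K.
      real_cond_exp (mu \<omega> X K) (sigma_alg_star \<omega> X K (A i)) (indicator (S i)) x = c"
  shows "(dens K (\<lambda>n. {p \<in> K \<rightarrow>\<^sub>E X n. \<forall>i\<in>I. p \<in> cyl K (A i) (B i) n})
    \<longlongrightarrow> (\<Prod>i\<in>I. internal_measure \<omega> X K (cyl K (A i) (B i)))) \<omega>"
  using I inj AK B c
proof (induction rule: finite_ranking_induct[where f = "\<lambda>i. card (A i)"])
  case empty
  have "dens K (\<lambda>n. K \<rightarrow>\<^sub>E X n) = (\<lambda>n. 1)"
    using card_power_pos[OF K] by (simp add: dens_def fun_eq_iff less_imp_neq[THEN not_sym])
  then show ?case by simp
next
  case (insert r J)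
  show ?case
  \<comment> \<open>The ranking rule does not guarantee that \<open>r\<close> is new; if it is not,
    the induction hypothesis is already the claim.\<close>
  proof (cases "r \<in> J")
    case True
    then show ?thesis using insert by (simp add: insert_absorb)
  next
    case False
    define T where "T = cyl K (A r) (B r)"
    define W where "W n = {p \<in> K \<rightarrow>\<^sub>E X n. \<forall>i\<in>J. p \<in> cyl K (A i) (B i) n}" for n
    have fA: "finite (A i)" if "i \<in> insert r J" for i using insert.prems(2)[OF that] K finite_subset by blast
    have IH: "(dens K W \<longlongrightarrow> (\<Prod>i\<in>J. internal_measure \<omega> X K (cyl K (A i) (B i)))) \<omega>"
      unfolding W_def by (rule insert.IH) (use insert.prems in \<open>auto simp: inj_on_def\<close>)
    \<comment> \<open>If \<open>A r \<subseteq> A j\<close>, maximal cardinality would make the two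
      equal, against injectivity. So the intersection is proper and fits into a subset of
      \<open>A r\<close> with one element removed.\<close>
    have "\<exists>C. A j \<inter> A r \<subseteq> C \<and> C \<subseteq> A r \<and> card C = card (A r) - 1" if j: "j \<in> J" for j
    proof -
      have "\<not> A r \<subseteq> A j"
      proof
        assume "A r \<subseteq> A j"
        then have "A r = A j" using insert.hyps(2)[OF j] fA[of j] j by (intro card_seteq) auto
        then show False using insert.prems(1) j False by (auto simp: inj_on_def)
      qed
      then have "A j \<inter> A r \<subset> A r" by blast
      with fA[of r] show ?thesis by (metis exists_card_pred_superset insertI1)
    qed
    then obtain C where C: "\<And>j. j \<in> J \<Longrightarrow> A j \<inter> A r \<subseteq> C j \<and> C j \<subseteq> A r \<and> card (C j) = card (A r) - 1"
      by metis
    have TA: "splice_on K (A r) x y \<in> T n \<longleftrightarrow> x \<in> T n" if "x \<in> K \<rightarrow>\<^sub>E X n" "y \<in> K \<rightarrow>\<^sub>E X n" for x y n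
    proof -
      have "restrict (splice_on K (A r) x y) (A r) = restrict x (A r)"
        using insert.prems(2)[of r] by (intro restrict_ext) (auto simp: splice_on_def)
      then show ?thesis using that splice_on_in_PiE[OF that] by (simp add: T_def cyl_def)
    qed
    define gap where "gap D n = \<bar>dens K (\<lambda>i. T i \<inter> D i) n - dens K T n * dens K D n\<bar>" for D n
    \<comment> \<open>One point \<open>y\<close> is used at every index here, although it lies in
      the power of a single stage only. Since \<open>dens\<close> at \<open>n\<close> looks only at
      the \<open>n\<close>-th set, \<open>section_gap (y n) n\<close> equals \<open>gap V n\<close>
      for the sequence \<open>V\<close> of sections at the varying points
      \<open>y n\<close>.\<close>
    define section_gap
      where "section_gap y = gap (\<lambda>i. {x \<in> K \<rightarrow>\<^sub>E X i. splice_on K (A r) x y \<in> W i})" for y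
    have "\<exists>y. y \<in> K \<rightarrow>\<^sub>E X n \<and> gap W n \<le> section_gap y n" for n
    proof (rule dens_diff_splice_bound[of K T n W "A r", OF K _ _ TA])
      show "T n \<subseteq> K \<rightarrow>\<^sub>E X n" "W n \<subseteq> K \<rightarrow>\<^sub>E X n" by (auto simp: T_def W_def cyl_def)
    qed (assumption, assumption, unfold section_gap_def gap_def, intro exI conjI)
    then obtain y where y: "\<And>n. y n \<in> K \<rightarrow>\<^sub>E X n"
      "\<And>n. gap W n \<le> section_gap (y n) n" by metis
    define V where "V n = {x \<in> K \<rightarrow>\<^sub>E X n. splice_on K (A r) x (y n) \<in> W n}" for n
    define E where "E j n = (\<lambda>x. restrict x (C j)) `
      {x \<in> K \<rightarrow>\<^sub>E X n. splice_on K (A r) x (y n) \<in> cyl K (A j) (B j) n}" for j n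
    have CK: "C j \<subseteq> K" if "j \<in> J" for j using C[OF that] insert.prems(2)[of r] by auto
    have E: "set_seq X (C j) (E j)" if "j \<in> J" for j
      using CK[OF that] by (auto simp: set_seq_def E_def)
    have cylE: "{x \<in> K \<rightarrow>\<^sub>E X n. splice_on K (A r) x (y n) \<in> cyl K (A j) (B j) n} = cyl K (C j) (E j) n"
      if "j \<in> J" for j n
      unfolding E_def[abs_def]
      by (rule cyl_splice_on) (use C[OF that] CK[OF that] insert.prems(2)[of j] that in auto)
    \<comment> \<open>The splice lies in the power because \<open>y n\<close> does, so only the
      conditions for the individual \<open>j\<close> remain, and \<open>cylE\<close> makes each a
      cylinder over \<open>C j\<close>.\<close>
    have V: "V n = {p \<in> K \<rightarrow>\<^sub>E X n. \<forall>j\<in>J. p \<in> cyl K (C j) (E j) n}" for n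
      using splice_on_in_PiE[OF _ y(1)[of n]]
      by (simp add: V_def W_def cylE[symmetric] cong: conj_cong)
    obtain d where d: "AE x in mu \<omega> X K.
        real_cond_exp (mu \<omega> X K) (sigma_alg_star \<omega> X K (A r)) (indicator (S r)) x = d"
      using insert.prems(5)[of r] by auto
    have "((\<lambda>n. dens K (\<lambda>n. T n \<inter> V n) n - dens K T n * dens K V n) \<longlongrightarrow> 0) \<omega>"
    proof (rule dens_Int_star_tendsto[OF K _ insert.hyps(1) _ _ d])
      show "A r \<subseteq> K" "approximates \<omega> X K T (S r)" "S r \<subseteq> ultraprod \<omega> X K"
        using insert.prems(2,3,4)[of r] by (simp_all add: T_def)
      show "C j \<subseteq> A r \<and> card (C j) = card (A r) - 1" "set_seq X (C j) (E j)" if "j \<in> J" for j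
        using C[OF that] E[OF that] by simp_all
    qed (rule V)
    from tendsto_rabs_zero[OF this] have "(gap V \<longlongrightarrow> 0) \<omega>" by (simp add: gap_def[abs_def])
    moreover have "section_gap (y n) n = gap V n" for n
      by (simp add: section_gap_def gap_def dens_def V_def)
    with y(2) have "gap W n \<le> gap V n" for n by metis
    ultimately have "((\<lambda>n. dens K (\<lambda>n. T n \<inter> W n) n - dens K T n * dens K W n) \<longlongrightarrow> 0) \<omega>"
      by - (rule Lim_null_comparison[of _ "gap V", OF always_eventually], simp_all add: gap_def)
    moreover have "((\<lambda>n. dens K T n * dens K W n) \<longlongrightarrow> internal_measure \<omega> X K T *
        (\<Prod>i\<in>J. internal_measure \<omega> X K (cyl K (A i) (B i)))) \<omega>"
      unfolding T_def by (intro tendsto_mult dens_tendsto[OF K set_seq_cyl] IH)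
    ultimately have "(dens K (\<lambda>n. T n \<inter> W n) \<longlongrightarrow> internal_measure \<omega> X K T *
        (\<Prod>i\<in>J. internal_measure \<omega> X K (cyl K (A i) (B i)))) \<omega>"
      by (rule Lim_transform[rotated])
    moreover have "(\<lambda>n. T n \<inter> W n) = (\<lambda>n. {p \<in> K \<rightarrow>\<^sub>E X n. \<forall>i\<in>insert r J. p \<in> cyl K (A i) (B i) n})"
      by (auto simp: T_def W_def cyl_def)
    ultimately show ?thesis using False insert.hyps(1) by (simp add: T_def)
  qed
qed

text \<open>The cylinders approximating the \<open>S i\<close> have the same measures, and by
  \<open>approximates_INT\<close> their intersection approximates that of the \<open>S i\<close>.
  Both sides thus become internal measures of cylinder sequences, compared by
  \<open>dens_INT_tendsto\<close>.\<close>

theorem measure_INT_eq_prod: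
  assumes K: "finite K" and I: "finite I" and inj: "inj_on A I"
    and AK: "\<And>i. i \<in> I \<Longrightarrow> A i \<subseteq> K"
    and S: "\<And>i. i \<in> I \<Longrightarrow> S i \<in> sets (sigma_alg \<omega> X K (A i))"
    and c: "\<And>i. i \<in> I \<Longrightarrow> \<exists>c. AE x in mu \<omega> X K.
      real_cond_exp (mu \<omega> X K) (sigma_alg_star \<omega> X K (A i)) (indicator (S i)) x = c"
  shows "measure (mu \<omega> X K) (ultraprod \<omega> X K \<inter> (\<Inter>i\<in>I. S i)) = (\<Prod>i\<in>I. measure (mu \<omega> X K) (S i))"
proof -
  have "\<exists>B. approximates \<omega> X K (cyl K (A i) B) (S i) \<and> S i \<subseteq> ultraprod \<omega> X K" if "i \<in> I" for i
    using sigma_alg_approximates_cyl[OF K AK S] that by metis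
  then obtain B where B: "\<And>i. i \<in> I \<Longrightarrow> approximates \<omega> X K (cyl K (A i) (B i)) (S i)"
    "\<And>i. i \<in> I \<Longrightarrow> S i \<subseteq> ultraprod \<omega> X K" by metis
  have "measure (mu \<omega> X K) (ultraprod \<omega> X K \<inter> (\<Inter>i\<in>I. S i))
      = internal_measure \<omega> X K (\<lambda>n. {p \<in> K \<rightarrow>\<^sub>E X n. \<forall>i\<in>I. p \<in> cyl K (A i) (B i) n})"
    using B by (intro measure_mu[OF K] approximates_INT[OF K I]) auto
  also have "\<dots> = (\<Prod>i\<in>I. internal_measure \<omega> X K (cyl K (A i) (B i)))"
    by (rule internal_measureI[OF dens_INT_tendsto[OF K I inj AK B c]])
  also have "\<dots> = (\<Prod>i\<in>I. measure (mu \<omega> X K) (S i))"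
    using measure_mu[OF K B] by (intro prod.cong) auto
  finally show ?thesis .
qed

end

theorem mainTheorem10:
  fixes X :: "nat \<Rightarrow> 'a set" and \<omega> :: "nat filter" and k r :: nat
    and A :: "nat \<Rightarrow> nat set" and S :: "nat \<Rightarrow> (nat \<Rightarrow> nat \<Rightarrow> 'a) set set"
  assumes "\<And>n. finite (X n)" and "\<And>n. X n \<noteq> {}"
    and "strict_mono (\<lambda>n. card (X n))"
    and "nonprincipal_ultrafilter \<omega>"
    and "\<And>i. i \<in> {1..r} \<Longrightarrow> A i \<subseteq> {1..k}" and "\<And>i. i \<in> {1..r} \<Longrightarrow> A i \<noteq> {}"
    and "inj_on A {1..r}"
    and "\<And>i. i \<in> {1..r} \<Longrightarrow> S i \<in> sets (sigma_alg \<omega> X {1..k} (A i))"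
    and "\<And>i. i \<in> {1..r} \<Longrightarrow>
      \<exists>c. AE x in mu \<omega> X {1..k}.
        real_cond_exp (mu \<omega> X {1..k}) (sigma_alg_star \<omega> X {1..k} (A i)) (indicator (S i)) x = c"
  shows "measure (mu \<omega> X {1..k}) (ultraprod \<omega> X {1..k} \<inter> (\<Inter>i\<in>{1..r}. S i))
    = (\<Prod>i\<in>{1..r}. measure (mu \<omega> X {1..k}) (S i))"
proof -
  interpret ultra_seq X \<omega>
    using assms(1,2,4) by unfold_locales
  show ?thesis
    using assms(5,7,8,9) by (intro measure_INT_eq_prod) auto
qed

end
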